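(* Let $X$ be a set and $\lambda,q\in\mathbf{k}$, and let $j_X:X\to\mathrm{DT}(\Delta X)$ send $x$ to the tree with a single internal vertex (two leaves) decorated by $x^{(0)}$. Then $(\mathrm{DT}(\Delta X),\prec,\succ,\bullet,d_X)$ together with $j_X$ is the free differential $q$-tridendriform algebra of weight $\lambda$ on $X$: for every differential $q$-tridendriform algebra $(T,\prec_T,\succ_T,\bullet_T,d_T)$ of weight $\lambda$ and every map of sets $f:X\to T$, there is a unique linear map $\bar f:\mathrm{DT}(\Delta X)\to T$ preserving $\prec,\succ,\bullet$, satisfying $d_T\bar f=\bar f d_X$ and $\bar f j_X=f$.
   Context: $\mathbf{k}$ is a commutative unital ring. For a set $Y$, a valently decorated Schröder tree over $Y$ is a planar rooted tree in which every internal vertex has $k\ge2$ (ordered) children and is decorated by an element of $Y^{k-1}$; the tree with one leaf and no internal vertex is denoted $|$. Every tree $\tau\ne|$ is uniquely a grafting $\tau=\bigvee^{m+1}_{y_1,\dots,y_m}(\tau^{(0)},\dots,\tau^{(m)})$ ($m\ge1$) of trees $\tau^{(0)},\dots,\tau^{(m)}$ onto a new root decorated by $(y_1,\dots,y_m)$. Let $\mathrm{DT}(Y)$ be the free $\mathbf{k}$-module on all such trees other than $|$. Define bilinear $\prec,\succ,\bullet$ on $\mathrm{DT}(Y)$ recursively on total depth: for $\tau\ne|$, $|\succ\tau:=\tau\prec|:=\tau$, $|\prec\tau:=\tau\succ|:=0$, $|\bullet\tau:=\tau\bullet|:=0$, with the convention $|\prec|+|\succ|+q\,|\bullet|:=|$;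 and for $\tau=\bigvee^{m+1}_{x_1,\dots,x_m}(\tau^{(0)},\dots,\tau^{(m)})$, $\sigma=\bigvee^{n+1}_{y_1,\dots,y_n}(\sigma^{(0)},\dots,\sigma^{(n)})$, writing $u\star_q v:=u\succ v+u\prec v+q\,u\bullet v$: $\tau\prec\sigma:=\bigvee^{m+1}_{x_1,\dots,x_m}(\tau^{(0)},\dots,\tau^{(m-1)},\tau^{(m)}\star_q\sigma)$, $\tau\succ\sigma:=\bigvee^{n+1}_{y_1,\dots,y_n}(\tau\star_q\sigma^{(0)},\sigma^{(1)},\dots,\sigma^{(n)})$, $\tau\bullet\sigma:=\bigvee^{m+n+1}_{x_1,\dots,x_m,y_1,\dots,y_n}(\tau^{(0)},\dots,\tau^{(m-1)},\tau^{(m)}\star_q\sigma^{(0)},\sigma^{(1)},\dots,\sigma^{(n)})$ (grafting extended multilinearly). Let $\Delta X:=X\times\mathbb N=\{x^{(n)}\mid x\in X,n\ge0\}$ and take $Y=\Delta X$. Define $d_X:\mathrm{DT}(\Delta X)\to\mathrm{DT}(\Delta X)$ linearly by: if $\tau$ has decoration entries $x_1^{(r_1)},\dots,x_N^{(r_N)}$ (all entries of all vertex decorations, listed in some order), then $d_X(\tau)=\sum_{\emptyset\ne S\subseteq\{1,\dots,N\}}\lambda^{|S|-1}\tau_S$, where $\tau_S$ is the tree of the same shape with each entry $x_i^{(r_i)}$, $i\in S$, replaced by $x_i^{(r_i+1)}$. For $q\in\mathbf{k}$, a $q$-tridendriform algebra is a $\mathbf{k}$-module $T$ with bilinear operations $\prec,\succ,\bullet$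 such that, writing $\star_q:=\prec+\succ+q\bullet$, for all $a,b,c\in T$: $(a\prec b)\prec c=a\prec(b\star_q c)$, $(a\succ b)\prec c=a\succ(b\prec c)$, $(a\star_q b)\succ c=a\succ(b\succ c)$, $(a\succ b)\bullet c=a\succ(b\bullet c)$, $(a\prec b)\bullet c=a\bullet(b\succ c)$, $(a\bullet b)\prec c=a\bullet(b\prec c)$, $(a\bullet b)\bullet c=a\bullet(b\bullet c)$. A derivation of weight $\lambda$ on it is a linear map $d$ with $d(a\ast b)=d(a)\ast b+a\ast d(b)+\lambda d(a)\ast d(b)$ for each $\ast\in\{\prec,\succ,\bullet\}$ and all $a,b$; then $(T,\prec,\succ,\bullet,d)$ is a differential $q$-tridendriform algebra of weight $\lambda$. *)

theory Defs
  imports Main "HOL.Modules" "HOL-Library.Poly_Mapping"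
begin

text \<open>Raw trees: Leaf is the tree with one leaf and no internal vertex;
  Node ys ts is the grafting of the children ts onto a root decorated by ys.\<close>
datatype 'y tree = Leaf | Node "'y list" "'y tree list"

fun valid_tree :: "'y tree \<Rightarrow> bool" where
  "valid_tree Leaf = True"
| "valid_tree (Node ys ts) \<longleftrightarrow> ys \<noteq> [] \<and> length ts = Suc (length ys) \<and> (\<forall>t\<in>set ts. valid_tree t)"

type_synonym ('y, 'k) lc = "'y tree \<Rightarrow>\<^sub>0 'k"

definition lc_scale :: "'k::comm_ring_1 \<Rightarrow> ('y, 'k) lc \<Rightarrow> ('y, 'k) lc" where
  "lc_scale c p = Poly_Mapping.map (\<lambda>a. c * a) p"

definition basis :: "'y tree \<Rightarrow> ('y, 'k::comm_ring_1) lc" where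
  "basis t = Poly_Mapping.single t 1"

definition DT :: "('y, 'k::comm_ring_1) lc set" where
  "DT = {p. \<forall>t\<in>Poly_Mapping.keys p. valid_tree t \<and> t \<noteq> Leaf}"

definition linext :: "('y tree \<Rightarrow> ('z, 'k::comm_ring_1) lc) \<Rightarrow> ('y, 'k) lc \<Rightarrow> ('z, 'k) lc" where
  "linext g p = (\<Sum>t\<in>Poly_Mapping.keys p. lc_scale (Poly_Mapping.lookup p t) (g t))"

definition bilinext :: "('y tree \<Rightarrow> 'y tree \<Rightarrow> ('y, 'k::comm_ring_1) lc)
    \<Rightarrow> ('y, 'k) lc \<Rightarrow> ('y, 'k) lc \<Rightarrow> ('y, 'k) lc" where
  "bilinext g p r = (\<Sum>t\<in>Poly_Mapping.keys p. \<Sum>s\<in>Poly_Mapping.keys r. lc_scale (Poly_Mapping.lookup p t * Poly_Mapping.lookup r s) (g t s))"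

definition graft :: "'y list \<Rightarrow> 'y tree list \<Rightarrow> 'y tree list \<Rightarrow> ('y, 'k::comm_ring_1) lc \<Rightarrow> ('y, 'k) lc" where
  "graft ys pre post p = linext (\<lambda>u. basis (Node ys (pre @ u # post))) p"

text \<open>star q t s is  t \<succ> s + t \<prec> s + q (t \<bullet> s)  on basis trees, including the
  conventions involving Leaf (with Leaf \<star> Leaf = Leaf).  It is defined by recursion on
  the total size; the three operations are then read off non-recursively.\<close>
lemma size_last_less: "ts \<noteq> [] \<Longrightarrow> size (last ts) \<le> size_list size ts"
  by (rule size_list_estimation'[of "last ts"]) auto

lemma size_hd_less: "ss \<noteq> [] \<Longrightarrow> size (hd ss) \<le> size_list size ss"
  by (rule size_list_estimation'[of "hd ss"]) auto

function star :: "'k::comm_ring_1 \<Rightarrow> 'y tree \<Rightarrow> 'y tree \<Rightarrow> ('y, 'k) lc" where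
  "star q Leaf Leaf = basis Leaf"
| "star q Leaf (Node ys ss) = basis (Node ys ss)"
| "star q (Node xs ts) Leaf = basis (Node xs ts)"
| "star q (Node xs ts) (Node ys ss) =
    (if ts = [] \<or> ss = [] then 0 else
       graft xs (butlast ts) [] (star q (last ts) (Node ys ss))
     + graft ys [] (tl ss) (star q (Node xs ts) (hd ss))
     + lc_scale q (graft (xs @ ys) (butlast ts) (tl ss) (star q (last ts) (hd ss))))"
  by pat_completeness auto
termination
  apply (relation "measure (\<lambda>(q, t, s). size t + size s)")
  apply auto
  using size_last_less size_hd_less by fastforce+

fun precb :: "'k::comm_ring_1 \<Rightarrow> 'y tree \<Rightarrow> 'y tree \<Rightarrow> ('y, 'k) lc" where
  "precb q Leaf s = 0"
| "precb q (Node xs ts) Leaf = basis (Node xs ts)"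
| "precb q (Node xs ts) (Node ys ss) =
    (if ts = [] then 0 else graft xs (butlast ts) [] (star q (last ts) (Node ys ss)))"

fun succb :: "'k::comm_ring_1 \<Rightarrow> 'y tree \<Rightarrow> 'y tree \<Rightarrow> ('y, 'k) lc" where
  "succb q t Leaf = 0"
| "succb q Leaf (Node ys ss) = basis (Node ys ss)"
| "succb q (Node xs ts) (Node ys ss) =
    (if ss = [] then 0 else graft ys [] (tl ss) (star q (Node xs ts) (hd ss)))"

fun bullb :: "'k::comm_ring_1 \<Rightarrow> 'y tree \<Rightarrow> 'y tree \<Rightarrow> ('y, 'k) lc" where
  "bullb q Leaf s = 0"
| "bullb q (Node xs ts) Leaf = 0"
| "bullb q (Node xs ts) (Node ys ss) =
    (if ts = [] \<or> ss = [] then 0 else graft (xs @ ys) (butlast ts) (tl ss) (star q (last ts) (hd ss)))"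

definition DT_prec :: "'k::comm_ring_1 \<Rightarrow> ('y, 'k) lc \<Rightarrow> ('y, 'k) lc \<Rightarrow> ('y, 'k) lc" where
  "DT_prec q = bilinext (precb q)"
definition DT_succ :: "'k::comm_ring_1 \<Rightarrow> ('y, 'k) lc \<Rightarrow> ('y, 'k) lc \<Rightarrow> ('y, 'k) lc" where
  "DT_succ q = bilinext (succb q)"
definition DT_bull :: "'k::comm_ring_1 \<Rightarrow> ('y, 'k) lc \<Rightarrow> ('y, 'k) lc \<Rightarrow> ('y, 'k) lc" where
  "DT_bull q = bilinext (bullb q)"

text \<open>Delta X = X \<times> N, the pair (x, n) standing for x^(n).\<close>

fun nent :: "'y tree \<Rightarrow> nat" where
  "nent Leaf = 0"
| "nent (Node ys ts) = length ys + sum_list (map nent ts)"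

text \<open>Apply f i to the i-th decoration entry (entries numbered in preorder, from n).\<close>
fun mapi_tree :: "(nat \<Rightarrow> 'y \<Rightarrow> 'z) \<Rightarrow> nat \<Rightarrow> 'y tree \<Rightarrow> 'z tree"
and mapi_trees :: "(nat \<Rightarrow> 'y \<Rightarrow> 'z) \<Rightarrow> nat \<Rightarrow> 'y tree list \<Rightarrow> 'z tree list" where
  "mapi_tree f n Leaf = Leaf"
| "mapi_tree f n (Node ys ts) =
     Node (map2 f [n..<n + length ys] ys) (mapi_trees f (n + length ys) ts)"
| "mapi_trees f n [] = []"
| "mapi_trees f n (t # ts) = mapi_tree f n t # mapi_trees f (n + nent t) ts"

definition raise_at :: "nat set \<Rightarrow> ('x \<times> nat) tree \<Rightarrow> ('x \<times> nat) tree" where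
  "raise_at S t = mapi_tree (\<lambda>i (x, r). if i \<in> S then (x, Suc r) else (x, r)) 0 t"

definition dX_basis :: "'k::comm_ring_1 \<Rightarrow> ('x \<times> nat) tree \<Rightarrow> ('x \<times> nat, 'k) lc" where
  "dX_basis lam t = (\<Sum>S\<in>{S. S \<subseteq> {..<nent t} \<and> S \<noteq> {}}.
       lc_scale (lam ^ (card S - 1)) (basis (raise_at S t)))"

definition dX :: "'k::comm_ring_1 \<Rightarrow> ('x \<times> nat, 'k) lc \<Rightarrow> ('x \<times> nat, 'k) lc" where
  "dX lam = linext (dX_basis lam)"

definition jX :: "'x \<Rightarrow> ('x \<times> nat) tree" where
  "jX x = Node [(x, 0)] [Leaf, Leaf]"

text \<open>A k-module is represented as a submodule A (the carrier) of an ambient k-module on a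
  type 'b with scalar multiplication sc.\<close>
definition bilinear_on :: "('k::comm_ring_1 \<Rightarrow> 'b::ab_group_add \<Rightarrow> 'b) \<Rightarrow> 'b set \<Rightarrow> ('b \<Rightarrow> 'b \<Rightarrow> 'b) \<Rightarrow> bool" where
  "bilinear_on sc A m \<longleftrightarrow>
     (\<forall>a\<in>A. \<forall>b\<in>A. m a b \<in> A) \<and>
     (\<forall>a\<in>A. \<forall>b\<in>A. \<forall>c\<in>A. m (a + b) c = m a c + m b c \<and> m a (b + c) = m a b + m a c) \<and>
     (\<forall>k. \<forall>a\<in>A. \<forall>b\<in>A. m (sc k a) b = sc k (m a b) \<and> m a (sc k b) = sc k (m a b))"

definition q_tridendriform :: "('k::comm_ring_1 \<Rightarrow> 'b::ab_group_add \<Rightarrow> 'b) \<Rightarrow> 'b set \<Rightarrow> 'k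
    \<Rightarrow> ('b \<Rightarrow> 'b \<Rightarrow> 'b) \<Rightarrow> ('b \<Rightarrow> 'b \<Rightarrow> 'b) \<Rightarrow> ('b \<Rightarrow> 'b \<Rightarrow> 'b) \<Rightarrow> bool" where
  "q_tridendriform sc A q pr su bu \<longleftrightarrow>
     module sc \<and>
     (0 \<in> A \<and> (\<forall>x\<in>A. \<forall>y\<in>A. x + y \<in> A) \<and> (\<forall>c. \<forall>x\<in>A. sc c x \<in> A)) \<and>
     bilinear_on sc A pr \<and> bilinear_on sc A su \<and> bilinear_on sc A bu \<and>
     (let st = (\<lambda>a b. pr a b + su a b + sc q (bu a b)) in
      \<forall>a\<in>A. \<forall>b\<in>A. \<forall>c\<in>A.
        pr (pr a b) c = pr a (st b c) \<and>
        pr (su a b) c = su a (pr b c) \<and>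
        su (st a b) c = su a (su b c) \<and>
        bu (su a b) c = su a (bu b c) \<and>
        bu (pr a b) c = bu a (su b c) \<and>
        pr (bu a b) c = bu a (pr b c) \<and>
        bu (bu a b) c = bu a (bu b c))"

definition derivation_wt :: "('k::comm_ring_1 \<Rightarrow> 'b::ab_group_add \<Rightarrow> 'b) \<Rightarrow> 'b set \<Rightarrow> 'k
    \<Rightarrow> ('b \<Rightarrow> 'b \<Rightarrow> 'b) \<Rightarrow> ('b \<Rightarrow> 'b) \<Rightarrow> bool" where
  "derivation_wt sc A lam m d \<longleftrightarrow>
     (\<forall>a\<in>A. \<forall>b\<in>A. d (m a b) = m (d a) b + m a (d b) + sc lam (m (d a) (d b)))"

definition linear_on :: "('k::comm_ring_1 \<Rightarrow> 'b::ab_group_add \<Rightarrow> 'b) \<Rightarrow> 'b set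
    \<Rightarrow> ('k \<Rightarrow> 'c::ab_group_add \<Rightarrow> 'c) \<Rightarrow> 'c set \<Rightarrow> ('b \<Rightarrow> 'c) \<Rightarrow> bool" where
  "linear_on sa A sb B g \<longleftrightarrow>
     (\<forall>a\<in>A. g a \<in> B) \<and> (\<forall>a\<in>A. \<forall>b\<in>A. g (a + b) = g a + g b) \<and>
     (\<forall>k. \<forall>a\<in>A. g (sa k a) = sb k (g a))"

definition diff_q_tridendriform :: "('k::comm_ring_1 \<Rightarrow> 'b::ab_group_add \<Rightarrow> 'b) \<Rightarrow> 'b set \<Rightarrow> 'k \<Rightarrow> 'k
    \<Rightarrow> ('b \<Rightarrow> 'b \<Rightarrow> 'b) \<Rightarrow> ('b \<Rightarrow> 'b \<Rightarrow> 'b) \<Rightarrow> ('b \<Rightarrow> 'b \<Rightarrow> 'b) \<Rightarrow> ('b \<Rightarrow> 'b) \<Rightarrow> bool" where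
  "diff_q_tridendriform sc A q lam pr su bu d \<longleftrightarrow>
     q_tridendriform sc A q pr su bu \<and> linear_on sc A sc A d \<and>
     derivation_wt sc A lam pr d \<and> derivation_wt sc A lam su d \<and> derivation_wt sc A lam bu d"

definition diff_tri_hom :: "('k::comm_ring_1 \<Rightarrow> 'b::ab_group_add \<Rightarrow> 'b) \<Rightarrow> 'b set
    \<Rightarrow> ('b \<Rightarrow> 'b \<Rightarrow> 'b) \<Rightarrow> ('b \<Rightarrow> 'b \<Rightarrow> 'b) \<Rightarrow> ('b \<Rightarrow> 'b \<Rightarrow> 'b) \<Rightarrow> ('b \<Rightarrow> 'b)
    \<Rightarrow> ('k \<Rightarrow> 'c::ab_group_add \<Rightarrow> 'c) \<Rightarrow> 'c set
    \<Rightarrow> ('c \<Rightarrow> 'c \<Rightarrow> 'c) \<Rightarrow> ('c \<Rightarrow> 'c \<Rightarrow> 'c) \<Rightarrow> ('c \<Rightarrow> 'c \<Rightarrow> 'c) \<Rightarrow> ('c \<Rightarrow> 'c)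
    \<Rightarrow> ('b \<Rightarrow> 'c) \<Rightarrow> bool" where
  "diff_tri_hom sa A pa ua ba da sb B pb ub bb db g \<longleftrightarrow>
     linear_on sa A sb B g \<and>
     (\<forall>a\<in>A. \<forall>b\<in>A. g (pa a b) = pb (g a) (g b) \<and> g (ua a b) = ub (g a) (g b)
                    \<and> g (ba a b) = bb (g a) (g b)) \<and>
     (\<forall>a\<in>A. db (g a) = g (da a))"

end

theory Submission
  imports Defs "HOL-Library.Product_Plus"
begin

text \<open>Associativity of \<open>\<star>\<close> on trees follows by induction on the total size, because each tridendriform
  axiom on basis trees either reduces to associativity of \<open>\<star>\<close> on smaller trees or expresses that
  grafting at two different children commutes. A tree is built from one-vertex trees by
  \<open>\<or>\<^bsub>y\<^esub>(t,u) = (t \<succ> y) \<prec> u\<close> and \<open>\<or>\<^bsub>y,ys\<^esub>(t,ts) = (t \<succ> y) \<bullet> \<or>\<^bsub>ys\<^esub>(ts)\<close>; reading this as a recursion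
  evaluates trees in any tridendriform algebra, which shows that \<open>DT(Y)\<close> is free on \<open>Y\<close>.
  A linear map \<open>d\<close> is a derivation of weight \<open>\<lambda>\<close> iff \<open>a \<mapsto> a + d(a) \<epsilon>\<close> is a homomorphism into the algebra with
  scalars extended by \<open>\<epsilon>\<^sup>2 = \<lambda> \<epsilon>\<close>. Freeness over \<open>\<Delta>X\<close> thus identifies \<open>d\<^sub>X\<close> with the derivation
  determined by \<open>x\<^bsup>(n)\<^esup> \<mapsto> x\<^bsup>(n+1)\<^esup>\<close>, and reduces \<open>d\<^sub>T f = f d\<^sub>X\<close> to agreement of two
  homomorphisms on generators.\<close>

section \<open>Linear extension\<close>

text \<open>\<open>linext\<close> takes values in combinations of trees only; evaluation in an
  algebra needs an arbitrary target module. \<open>linext_eq_lext\<close> lets both share one set of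
  lemmas.\<close>

definition lext :: "('k::comm_ring_1 \<Rightarrow> 'b::ab_group_add \<Rightarrow> 'b) \<Rightarrow> ('y tree \<Rightarrow> 'b) \<Rightarrow> ('y, 'k) lc \<Rightarrow> 'b" where
  "lext sc g p = (\<Sum>t\<in>Poly_Mapping.keys p. sc (Poly_Mapping.lookup p t) (g t))"

lemma linext_eq_lext: "linext = lext lc_scale"
  by (intro ext) (simp add: linext_def lext_def)

lemma lookup_lc_scale [simp]: "Poly_Mapping.lookup (lc_scale c p) t = c * Poly_Mapping.lookup p t"
  by (simp add: lc_scale_def Poly_Mapping.map.rep_eq when_def)

lemma module_lc_scale: "module (lc_scale :: 'k::comm_ring_1 \<Rightarrow> ('y, 'k) lc \<Rightarrow> ('y, 'k) lc)"
  by unfold_locales (auto intro!: poly_mapping_eqI simp: lookup_add algebra_simps)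

lemmas lc_scale_simps [simp] =
  module.scale_zero_left [OF module_lc_scale] module.scale_zero_right [OF module_lc_scale]
  module.scale_one [OF module_lc_scale] module.scale_scale [OF module_lc_scale]

lemmas lc_scale_add = module.scale_right_distrib [OF module_lc_scale]

context module
begin

text \<open>Coefficients outside the support vanish, so combinations with different supports can be
  summed over a common finite set.\<close>

lemma lext_superset:
  assumes "finite S" "Poly_Mapping.keys p \<subseteq> S"
  shows "lext scale g p = (\<Sum>t\<in>S. Poly_Mapping.lookup p t *s g t)"
  unfolding lext_def using assms
  by (intro sum.mono_neutral_left) (auto simp: in_keys_iff)

lemma lext_zero [simp]: "lext scale g 0 = 0"
  by (simp add: lext_def)

lemma lext_add: "lext scale g (p + r) = lext scale g p + lext scale g r"
proof -
  let ?S = "Poly_Mapping.keys p \<union> Poly_Mapping.keys r"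
  have "Poly_Mapping.keys (p + r) \<subseteq> ?S"
    by (rule Poly_Mapping.keys_add)
  then show ?thesis
    by (simp add: lext_superset [of ?S] lookup_add scale_left_distrib sum.distrib)
qed

lemma lext_lc_scale: "lext scale g (lc_scale c p) = c *s lext scale g p"
proof -
  have "Poly_Mapping.keys (lc_scale c p) \<subseteq> Poly_Mapping.keys p"
    by (auto simp: in_keys_iff)
  then show ?thesis
    by (simp add: lext_superset [of "Poly_Mapping.keys p"] scale_sum_right)
qed

lemma lext_sum: "lext scale g (sum h I) = (\<Sum>i\<in>I. lext scale g (h i))"
  by (induction I rule: infinite_finite_induct) (auto simp: lext_add)

lemma lext_basis [simp]: "lext scale g (basis t) = g t"
  by (simp add: lext_def basis_def)

lemma lext_cong:
  "(\<And>t. t \<in> Poly_Mapping.keys p \<Longrightarrow> g t = h t) \<Longrightarrow> lext scale g p = lext scale h p"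
  by (simp add: lext_def)

lemma lext_fun_zero [simp]: "lext scale (\<lambda>t. 0) p = 0"
  by (simp add: lext_def)

lemma lext_fun_add: "lext scale (\<lambda>t. g t + h t) p = lext scale g p + lext scale h p"
  by (simp add: lext_def scale_right_distrib sum.distrib)

lemma lext_fun_scale: "lext scale (\<lambda>t. c *s g t) p = c *s lext scale g p"
  by (simp add: lext_def scale_sum_right mult.commute)

lemma lext_linext: "lext scale g (linext h p) = lext scale (\<lambda>t. lext scale g (h t)) p"
  by (simp add: linext_def lext_sum lext_lc_scale) (simp add: lext_def)

text \<open>Exchange of two finite sums, together with commutativity of the scalars.\<close>

lemma lext_commute:
  "lext scale (\<lambda>t. lext scale (g t) r) p = lext scale (\<lambda>s. lext scale (\<lambda>t. g t s) p) r"
  unfolding lext_def scale_sum_right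
  by (subst sum.swap) (simp add: mult.commute)

lemma lext_in:
  assumes "0 \<in> A" "\<And>x y. x \<in> A \<Longrightarrow> y \<in> A \<Longrightarrow> x + y \<in> A" "\<And>c x. x \<in> A \<Longrightarrow> c *s x \<in> A"
    and "\<And>t. t \<in> Poly_Mapping.keys p \<Longrightarrow> g t \<in> A"
  shows "lext scale g p \<in> A"
proof -
  have "finite I \<Longrightarrow> I \<subseteq> Poly_Mapping.keys p \<Longrightarrow> (\<Sum>t\<in>I. Poly_Mapping.lookup p t *s g t) \<in> A" for I
    by (induction I rule: finite_induct) (auto intro: assms)
  then show ?thesis
    by (simp add: lext_def)
qed

end

lemmas linext_zero [simp] = module.lext_zero [OF module_lc_scale, folded linext_eq_lext]
lemmas linext_add = module.lext_add [OF module_lc_scale, folded linext_eq_lext]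
lemmas linext_lc_scale = module.lext_lc_scale [OF module_lc_scale, folded linext_eq_lext]
lemmas linext_basis [simp] = module.lext_basis [OF module_lc_scale, folded linext_eq_lext]
lemmas linext_cong = module.lext_cong [OF module_lc_scale, folded linext_eq_lext]
lemmas linext_fun_zero [simp] = module.lext_fun_zero [OF module_lc_scale, folded linext_eq_lext]
lemmas linext_fun_add = module.lext_fun_add [OF module_lc_scale, folded linext_eq_lext]
lemmas linext_fun_scale = module.lext_fun_scale [OF module_lc_scale, folded linext_eq_lext]
lemmas linext_linext = module.lext_linext [OF module_lc_scale, folded linext_eq_lext]
lemmas linext_commute = module.lext_commute [OF module_lc_scale, folded linext_eq_lext]

lemma lookup_sum_lc: "Poly_Mapping.lookup (sum f I) t = (\<Sum>i\<in>I. Poly_Mapping.lookup (f i) t)"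
  by (induction I rule: infinite_finite_induct) (auto simp: lookup_add)

lemma linext_basis_right [simp]: "linext basis p = p"
proof (rule poly_mapping_eqI)
  fix t
  show "Poly_Mapping.lookup (linext basis p) t = Poly_Mapping.lookup p t"
    by (cases "t \<in> Poly_Mapping.keys p")
      (auto simp: linext_def basis_def lookup_sum_lc lookup_single when_def if_distrib in_keys_iff
        cong: if_cong)
qed

lemma keys_linext_cases:
  assumes "u \<in> Poly_Mapping.keys (linext g p)"
  obtains t where "t \<in> Poly_Mapping.keys p" "u \<in> Poly_Mapping.keys (g t)"
proof -
  have "(\<Sum>t\<in>Poly_Mapping.keys p. Poly_Mapping.lookup p t * Poly_Mapping.lookup (g t) u) \<noteq> 0"
    using assms by (simp add: linext_def lookup_sum_lc in_keys_iff)
  then obtain t where "t \<in> Poly_Mapping.keys p"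
      "Poly_Mapping.lookup p t * Poly_Mapping.lookup (g t) u \<noteq> 0"
    by (meson sum.neutral)
  then show ?thesis
    using that [of t] by (metis in_keys_iff mult_zero_right)
qed

lemma keys_basis [simp]: "Poly_Mapping.keys (basis t :: ('y, 'k::comm_ring_1) lc) = {t}"
  by (simp add: basis_def)

section \<open>Bilinear extension of products from trees to combinations\<close>

lemma bilinext_eq_linext: "bilinext g p r = linext (\<lambda>t. linext (g t) r) p"
  unfolding bilinext_def linext_def
  by (simp add: module.scale_sum_right [OF module_lc_scale])

lemma bilinext_basis [simp]: "bilinext g (basis t) (basis s) = g t s"
  by (simp add: bilinext_eq_linext)

lemma bilinext_add_left: "bilinext g (p + p') r = bilinext g p r + bilinext g p' r"
  and bilinext_add_right: "bilinext g p (r + r') = bilinext g p r + bilinext g p r'"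
  and bilinext_scale_left: "bilinext g (lc_scale c p) r = lc_scale c (bilinext g p r)"
  and bilinext_scale_right: "bilinext g p (lc_scale c r) = lc_scale c (bilinext g p r)"
  by (simp_all add: bilinext_eq_linext linext_add linext_lc_scale linext_fun_add linext_fun_scale)

text \<open>Four independent products are allowed so that each of the seven axioms is an instance.
  Only trees in the supports matter, which lets the axioms be proved for valid trees other than
  \<open>Leaf\<close>.\<close>

lemma bilinext_reassoc:
  assumes "\<And>t u v. t \<in> Poly_Mapping.keys p \<Longrightarrow> u \<in> Poly_Mapping.keys r \<Longrightarrow> v \<in> Poly_Mapping.keys s \<Longrightarrow>
    linext (\<lambda>w. g1 w v) (g2 t u) = linext (g3 t) (g4 u v)"
  shows "bilinext g1 (bilinext g2 p r) s = bilinext g3 p (bilinext g4 r s)"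
proof -
  have "bilinext g1 (bilinext g2 p r) s =
      linext (\<lambda>t. linext (\<lambda>u. linext (\<lambda>w. linext (g1 w) s) (g2 t u)) r) p"
    by (simp add: bilinext_eq_linext linext_linext)
  \<comment> \<open>The sum over \<open>s\<close> is moved outside the sum over the terms of
    \<open>g2 t u\<close>, so that \<open>t\<close>, \<open>u\<close> and \<open>v\<close> are fixed
    trees when the hypothesis is applied.\<close>
  also have "\<dots> = linext (\<lambda>t. linext (\<lambda>u. linext (\<lambda>v. linext (\<lambda>w. g1 w v) (g2 t u)) s) r) p"
    by (subst (3) linext_commute) simp
  also have "\<dots> = linext (\<lambda>t. linext (\<lambda>u. linext (\<lambda>v. linext (g3 t) (g4 u v)) s) r) p"
    by (intro linext_cong assms)
  also have "\<dots> = bilinext g3 p (bilinext g4 r s)"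
    by (simp add: bilinext_eq_linext linext_linext)
  finally show ?thesis .
qed

section \<open>The free module of trees as a tridendriform algebra\<close>

lemma graft_basis [simp]: "graft ys pre post (basis u) = basis (Node ys (pre @ u # post))"
  by (simp add: graft_def)

lemma linext_graft: "linext g (graft ys pre post p) = linext (\<lambda>u. g (Node ys (pre @ u # post))) p"
  by (simp add: graft_def linext_linext)

lemma graft_linext: "graft ys pre post (linext g p) = linext (\<lambda>u. graft ys pre post (g u)) p"
  by (simp add: graft_def linext_linext)

text \<open>Inserting \<open>p\<close> and \<open>r\<close> at two different child positions is
  bilinear in the pair, so either one may be expanded first.\<close>

lemma linext_graft_commute:
  "linext (\<lambda>u. graft ys (pre @ u # mid) post r) p = linext (\<lambda>v. graft ys pre (mid @ v # post) p) r"
  unfolding graft_def by (subst linext_commute) simp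

lemma star_Leaf_left [simp]: "star q Leaf s = basis s"
  by (cases s) auto

lemma star_Leaf_right [simp]: "star q s Leaf = basis s"
  by (cases s) auto

lemma star_Node_eq:
  assumes "ts \<noteq> []" "ss \<noteq> []"
  shows "star q (Node xs ts) (Node ys ss) = precb q (Node xs ts) (Node ys ss)
    + succb q (Node xs ts) (Node ys ss) + lc_scale q (bullb q (Node xs ts) (Node ys ss))"
  using assms by simp

declare star.simps(4) [simp del]

text \<open>Because \<open>star q t Leaf = basis t\<close>, one formula also covers
  \<open>s = Leaf\<close>. Together with its analogues for \<open>succb\<close> and
  \<open>bullb\<close>, it replaces the defining equations in \<open>last\<close>,
  \<open>butlast\<close>, \<open>hd\<close> and \<open>tl\<close>.\<close>

lemma precb_snoc [simp]: "precb q (Node xs (ts @ [t])) s = graft xs ts [] (star q t s)"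
  by (cases s) auto

lemma succb_Cons [simp]: "succb q t (Node ys (s # ss)) = graft ys [] ss (star q t s)"
  by (cases t) auto

lemma bullb_snoc_Cons [simp]:
  "bullb q (Node xs (ts @ [t])) (Node ys (s # ss)) = graft (xs @ ys) ts ss (star q t s)"
  by auto

declare precb.simps(3) [simp del] succb.simps(3) [simp del] bullb.simps(3) [simp del]

text \<open>A valid vertex has at least two children, so the first child, changed by
  \<open>\<succ>\<close>, and the last child, changed by \<open>\<prec>\<close>, are different
  positions.\<close>

lemma valid_tree_cases:
  assumes "valid_tree t" "t \<noteq> Leaf"
  obtains ys u mid v where "t = Node ys (u # mid @ [v])" "ys \<noteq> []" "length ys = Suc (length mid)"
    "valid_tree u" "\<forall>s\<in>set mid. valid_tree s" "valid_tree v"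
proof -
  obtain ys ts where t: "t = Node ys ts" "ys \<noteq> []" "length ts = Suc (length ys)"
      "\<forall>s\<in>set ts. valid_tree s"
    using assms by (cases t) auto
  then obtain u ts' where ts: "ts = u # ts'" "length ts' = length ys"
    by (cases ts) auto
  with t obtain mid v where "ts' = mid @ [v]"
    by (cases ts' rule: rev_cases) auto
  with t ts that show ?thesis
    by auto
qed

lemma star_nonleaf:
  assumes "valid_tree t" "valid_tree s" "t \<noteq> Leaf" "s \<noteq> Leaf"
  shows "star q t s = precb q t s + succb q t s + lc_scale q (bullb q t s)"
proof (rule valid_tree_cases [OF assms(1,3)], rule valid_tree_cases [OF assms(2,4)])
qed (simp add: star_Node_eq)

section \<open>Closure of \<open>DT\<close> under the products\<close>

abbreviation (input) valid_keys :: "('y, 'k::comm_ring_1) lc \<Rightarrow> bool" where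
  "valid_keys p \<equiv> (\<forall>w\<in>Poly_Mapping.keys p. valid_tree w)"

lemma DT_zero: "0 \<in> DT"
  and DT_add: "p \<in> DT \<Longrightarrow> r \<in> DT \<Longrightarrow> p + r \<in> DT"
  and DT_scale: "p \<in> DT \<Longrightarrow> lc_scale c p \<in> DT"
  using Poly_Mapping.keys_add [of p r] by (auto simp: DT_def in_keys_iff)

lemma basis_in_DT: "valid_tree t \<Longrightarrow> t \<noteq> Leaf \<Longrightarrow> basis t \<in> DT"
  by (simp add: DT_def)

lemma linext_in_DT: "(\<And>t. t \<in> Poly_Mapping.keys p \<Longrightarrow> g t \<in> DT) \<Longrightarrow> linext g p \<in> DT"
  unfolding linext_eq_lext
  by (rule module.lext_in [OF module_lc_scale]) (auto intro: DT_zero DT_add DT_scale)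

text \<open>\<open>Leaf\<close> may occur in \<open>p\<close>: it is an admissible child although it
  is excluded from \<open>DT\<close>.\<close>

lemma graft_in_DT:
  assumes "valid_keys p" "ys \<noteq> []" "length ys = length pre + length post"
    "\<forall>t\<in>set pre. valid_tree t" "\<forall>t\<in>set post. valid_tree t"
  shows "graft ys pre post p \<in> DT"
  unfolding graft_def using assms by (intro linext_in_DT basis_in_DT) auto

text \<open>Inductive step for the validity of \<open>star\<close>: each operation grafts a
  \<open>star\<close> product in which at least one factor has been replaced by one of its
  children.\<close>

lemma operations_in_DT_of_star:
  fixes t s :: "'y tree" and q :: "'k::comm_ring_1"
  assumes "valid_tree t" "valid_tree s" "t \<noteq> Leaf" "s \<noteq> Leaf"
    and star: "\<And>t' s' :: 'y tree. valid_tree t' \<Longrightarrow> valid_tree s' \<Longrightarrow> size t' + size s' < size t + size s \<Longrightarrow>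
      valid_keys (star q t' s')"
  shows "precb q t s \<in> DT \<and> succb q t s \<in> DT \<and> bullb q t s \<in> DT"
proof -
  obtain xs t1 tm t2 where t: "t = Node xs (t1 # tm @ [t2])" "xs \<noteq> []" "length xs = Suc (length tm)"
      "valid_tree t1" "\<forall>s\<in>set tm. valid_tree s" "valid_tree t2"
    by (rule valid_tree_cases [OF assms(1,3)])
  obtain ys s1 sm s2 where s: "s = Node ys (s1 # sm @ [s2])" "ys \<noteq> []" "length ys = Suc (length sm)"
      "valid_tree s1" "\<forall>s\<in>set sm. valid_tree s" "valid_tree s2"
    by (rule valid_tree_cases [OF assms(2,4)])
  have "precb q t s = graft xs (t1 # tm) [] (star q t2 s)"
    unfolding t using precb_snoc [of q xs "t1 # tm"] by simp
  moreover have "valid_keys (star q t2 s)"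
    using t(1) by (intro star t assms) simp
  then have "graft xs (t1 # tm) [] (star q t2 s) \<in> DT"
    using t(2-5) by (intro graft_in_DT) simp_all
  moreover have "succb q t s = graft ys [] (sm @ [s2]) (star q t s1)"
    unfolding s by simp
  moreover have "valid_keys (star q t s1)"
    using s(1) by (intro star s assms) simp
  then have "graft ys [] (sm @ [s2]) (star q t s1) \<in> DT"
    using s(2-6) by (intro graft_in_DT) auto
  moreover have "bullb q t s = graft (xs @ ys) (t1 # tm) (sm @ [s2]) (star q t2 s1)"
    unfolding t s using bullb_snoc_Cons [of q xs "t1 # tm"] by simp
  moreover have "valid_keys (star q t2 s1)"
    using t(1) s(1) by (intro star t s) simp
  then have "graft (xs @ ys) (t1 # tm) (sm @ [s2]) (star q t2 s1) \<in> DT"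
    using t(2-6) s(2-6) by (intro graft_in_DT) auto
  ultimately show ?thesis
    by simp
qed

lemma valid_star: "valid_tree t \<Longrightarrow> valid_tree s \<Longrightarrow> valid_keys (star q t s)"
proof (induction "size t + size s" arbitrary: t s rule: less_induct)
  case less
  show ?case
  proof (cases "t = Leaf \<or> s = Leaf")
    case True
    with less show ?thesis by auto
  next
    case False
    with less have "precb q t s \<in> DT \<and> succb q t s \<in> DT \<and> bullb q t s \<in> DT"
      by (intro operations_in_DT_of_star) auto
    then have "star q t s \<in> DT"
      using less False by (simp add: star_nonleaf DT_add DT_scale)
    then show ?thesis
      by (simp add: DT_def)
  qed
qed

lemma operations_in_DT:
  assumes "valid_tree t" "valid_tree s" "t \<noteq> Leaf" "s \<noteq> Leaf"
  shows precb_in_DT: "precb q t s \<in> DT" and succb_in_DT: "succb q t s \<in> DT"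
    and bullb_in_DT: "bullb q t s \<in> DT" and star_in_DT: "star q t s \<in> DT"
proof -
  have *: "precb q t s \<in> DT \<and> succb q t s \<in> DT \<and> bullb q t s \<in> DT"
    using assms by (intro operations_in_DT_of_star valid_star)
  then show "precb q t s \<in> DT" "succb q t s \<in> DT" "bullb q t s \<in> DT"
    by auto
  with assms show "star q t s \<in> DT"
    by (simp add: star_nonleaf DT_add DT_scale)
qed

text \<open>In the first, third and fifth identities all three factors meet in one child, where
  associativity of \<open>star\<close> on smaller trees applies. In the other four, \<open>a\<close>
  changes the first child of \<open>b\<close> and \<open>c\<close> the last one, and these two
  graftings commute.\<close>

lemma tridendriform_basis_of_star_assoc:
  fixes a b c :: "'y tree" and q :: "'k::comm_ring_1"
  assumes valid: "valid_tree a" "valid_tree b" "valid_tree c" "a \<noteq> Leaf" "b \<noteq> Leaf" "c \<noteq> Leaf"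
    and assoc: "\<And>t u v :: 'y tree. valid_tree t \<Longrightarrow> valid_tree u \<Longrightarrow> valid_tree v \<Longrightarrow>
      size t + size u + size v < size a + size b + size c \<Longrightarrow>
      linext (\<lambda>w. star q w v) (star q t u) = linext (star q t) (star q u v)"
  shows "linext (\<lambda>w. precb q w c) (precb q a b) = linext (precb q a) (star q b c)"
    and "linext (\<lambda>w. precb q w c) (succb q a b) = linext (succb q a) (precb q b c)"
    and "linext (\<lambda>w. succb q w c) (star q a b) = linext (succb q a) (succb q b c)"
    and "linext (\<lambda>w. bullb q w c) (succb q a b) = linext (succb q a) (bullb q b c)"
    and "linext (\<lambda>w. bullb q w c) (precb q a b) = linext (bullb q a) (succb q b c)"
    and "linext (\<lambda>w. precb q w c) (bullb q a b) = linext (bullb q a) (precb q b c)"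
    and "linext (\<lambda>w. bullb q w c) (bullb q a b) = linext (bullb q a) (bullb q b c)"
proof -
  obtain xs a1 am a2 where "a = Node xs (a1 # am @ [a2])" and a2: "valid_tree a2"
    by (rule valid_tree_cases [OF valid(1,4)])
  then obtain ts where a: "a = Node xs (ts @ [a2])"
    by (metis append_Cons)
  obtain ys b1 bm b2 where b: "b = Node ys (b1 # bm @ [b2])"
    by (rule valid_tree_cases [OF valid(2,5)])
  obtain zs c1 cm c2 where "c = Node zs (c1 # cm @ [c2])" and c1: "valid_tree c1"
    by (rule valid_tree_cases [OF valid(3,6)])
  then obtain cs where c: "c = Node zs (c1 # cs)"
    by metis
  \<comment> \<open>The prefix \<open>pre\<close> is empty when the left factor is \<open>b\<close>
    or a term of \<open>a \<succ> b\<close>, and is \<open>ts\<close> when it is a term of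
    \<open>a \<bullet> b\<close>.\<close>
  have bull_last: "bullb q (Node vs (pre @ t # bm @ [u])) c = graft (vs @ zs) (pre @ t # bm) cs (star q u c1)"
    for vs pre t u
    using bullb_snoc_Cons [of q vs "pre @ t # bm"] c by simp
  have prec_last: "precb q (Node vs (pre @ t # bm @ [u])) c = graft vs (pre @ t # bm) [] (star q u c)"
    for vs pre t u
    using precb_snoc [of q vs "pre @ t # bm"] by simp
  have bull_b: "bullb q a (Node vs (b1 # ss)) = graft (xs @ vs) ts ss (star q a2 b1)" for vs ss
    using a by simp
  have "linext (\<lambda>w. precb q w c) (precb q a b) = graft xs ts [] (linext (\<lambda>w. star q w c) (star q a2 b))"
    by (simp add: a linext_graft graft_linext)
  also have "\<dots> = graft xs ts [] (linext (star q a2) (star q b c))"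
    using assoc [of a2 b c] a a2 valid by simp
  also have "\<dots> = linext (precb q a) (star q b c)"
    by (simp add: a graft_linext precb_snoc [abs_def])
  finally show "linext (\<lambda>w. precb q w c) (precb q a b) = linext (precb q a) (star q b c)" .
  have "linext (\<lambda>w. succb q w c) (star q a b) = graft zs [] cs (linext (\<lambda>w. star q w c1) (star q a b))"
    by (simp add: c graft_linext)
  also have "\<dots> = graft zs [] cs (linext (star q a) (star q b c1))"
    using assoc [of a b c1] c c1 valid by simp
  also have "\<dots> = linext (succb q a) (succb q b c)"
    by (simp add: c linext_graft graft_linext)
  finally show "linext (\<lambda>w. succb q w c) (star q a b) = linext (succb q a) (succb q b c)" .
  have "linext (\<lambda>w. bullb q w c) (precb q a b) =
      graft (xs @ zs) ts cs (linext (\<lambda>w. star q w c1) (star q a2 b))"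
    by (simp add: a c linext_graft graft_linext)
  also have "\<dots> = graft (xs @ zs) ts cs (linext (star q a2) (star q b c1))"
    using assoc [of a2 b c1] a a2 c c1 valid by simp
  also have "\<dots> = linext (bullb q a) (succb q b c)"
    by (simp add: a c linext_graft graft_linext)
  finally show "linext (\<lambda>w. bullb q w c) (precb q a b) = linext (bullb q a) (succb q b c)" .
  note bull_last' = bull_last [of _ "[]", simplified] and prec_last' = prec_last [of _ "[]", simplified]
  have "linext (\<lambda>w. precb q w c) (succb q a b) =
      linext (\<lambda>u. graft ys (u # bm) [] (star q b2 c)) (star q a b1)"
    by (simp add: b linext_graft prec_last')
  also have "\<dots> = linext (\<lambda>v. graft ys [] (bm @ [v]) (star q a b1)) (star q b2 c)"
    by (rule linext_graft_commute [of "ys" "[]" bm "[]", simplified])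
  also have "\<dots> = linext (succb q a) (precb q b c)"
    by (simp add: b linext_graft prec_last')
  finally show "linext (\<lambda>w. precb q w c) (succb q a b) = linext (succb q a) (precb q b c)" .
  have "linext (\<lambda>w. bullb q w c) (succb q a b) =
      linext (\<lambda>u. graft (ys @ zs) (u # bm) cs (star q b2 c1)) (star q a b1)"
    by (simp add: b linext_graft bull_last')
  also have "\<dots> = linext (\<lambda>v. graft (ys @ zs) [] (bm @ v # cs) (star q a b1)) (star q b2 c1)"
    by (rule linext_graft_commute [of "ys @ zs" "[]" bm "cs", simplified])
  also have "\<dots> = linext (succb q a) (bullb q b c)"
    by (simp add: b linext_graft bull_last')
  finally show "linext (\<lambda>w. bullb q w c) (succb q a b) = linext (succb q a) (bullb q b c)" .
  have "linext (\<lambda>w. precb q w c) (bullb q a b) =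
      linext (\<lambda>u. graft (xs @ ys) (ts @ u # bm) [] (star q b2 c)) (star q a2 b1)"
    by (simp add: b linext_graft prec_last bull_b)
  also have "\<dots> = linext (\<lambda>v. graft (xs @ ys) ts (bm @ [v]) (star q a2 b1)) (star q b2 c)"
    by (rule linext_graft_commute [of "xs @ ys" "ts" bm "[]", simplified])
  also have "\<dots> = linext (bullb q a) (precb q b c)"
    by (simp add: b linext_graft prec_last' bull_b)
  finally show "linext (\<lambda>w. precb q w c) (bullb q a b) = linext (bullb q a) (precb q b c)" .
  have "linext (\<lambda>w. bullb q w c) (bullb q a b) =
      linext (\<lambda>u. graft (xs @ ys @ zs) (ts @ u # bm) cs (star q b2 c1)) (star q a2 b1)"
    by (simp add: b linext_graft bull_last bull_b)
  also have "\<dots> = linext (\<lambda>v. graft (xs @ ys @ zs) ts (bm @ v # cs) (star q a2 b1)) (star q b2 c1)"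
    by (rule linext_graft_commute [of "xs @ ys @ zs" "ts" bm "cs", simplified])
  also have "\<dots> = linext (bullb q a) (bullb q b c)"
    by (simp add: b linext_graft bull_last' bull_b)
  finally show "linext (\<lambda>w. bullb q w c) (bullb q a b) = linext (bullb q a) (bullb q b c)" .
qed

text \<open>A leaf is a unit for \<open>star\<close>. For three other trees, expanding both sides
  into the three operations makes them the same weighted sum of the seven axioms, each of which only
  requires associativity at smaller total size.\<close>

lemma star_assoc:
  fixes t u v :: "'y tree" and q :: "'k::comm_ring_1"
  assumes "valid_tree t" "valid_tree u" "valid_tree v"
  shows "linext (\<lambda>w. star q w v) (star q t u) = linext (star q t) (star q u v)"
  using assms
proof (induction "size t + size u + size v" arbitrary: t u v rule: less_induct)
  case less
  show ?case
  proof (cases "t = Leaf \<or> u = Leaf \<or> v = Leaf")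
    case True
    moreover have "star q Leaf = (basis :: 'y tree \<Rightarrow> ('y, 'k) lc)"
      by (rule ext) simp
    ultimately show ?thesis
      by auto
  next
    case False
    then have tuv: "t \<noteq> Leaf" "u \<noteq> Leaf" "v \<noteq> Leaf"
      by auto
    have IH: "linext (\<lambda>w. star q w v') (star q t' u') = linext (star q t') (star q u' v')"
      if "valid_tree t'" "valid_tree u'" "valid_tree v'"
        "size t' + size u' + size v' < size t + size u + size v" for t' u' v' :: "'y tree"
      using less.hyps that by blast
    note ax = tridendriform_basis_of_star_assoc [OF less.prems tuv IH]
    have ax3: "linext (\<lambda>w. succb q w v) (star q t u) = linext (succb q t) (succb q u v)"
      by (rule ax(3))
    have valid: "w \<in> Poly_Mapping.keys (star q t u) \<Longrightarrow> valid_tree w \<and> w \<noteq> Leaf"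
      "w \<in> Poly_Mapping.keys (star q u v) \<Longrightarrow> valid_tree w \<and> w \<noteq> Leaf" for w
      using star_in_DT [of t u q] star_in_DT [of u v q] less.prems tuv by (auto simp: DT_def)
    have tu: "star q t u = precb q t u + succb q t u + lc_scale q (bullb q t u)"
      and uv: "star q u v = precb q u v + succb q u v + lc_scale q (bullb q u v)"
      using less.prems tuv by (simp_all add: star_nonleaf)
    have "linext (\<lambda>w. star q w v) (star q t u) = linext (\<lambda>w. precb q w v) (star q t u)
        + linext (\<lambda>w. succb q w v) (star q t u) + lc_scale q (linext (\<lambda>w. bullb q w v) (star q t u))"
      unfolding linext_fun_add [symmetric] linext_fun_scale [symmetric]
      using valid(1) less.prems tuv by (intro linext_cong) (simp add: star_nonleaf)
    also have "\<dots> = linext (precb q t) (star q u v) + linext (succb q t) (star q u v)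
        + lc_scale q (linext (bullb q t) (star q u v))"
      \<comment> \<open>The axiom for \<open>(a \<star> b) \<succ> c\<close> needs the product
        \<open>star q t u\<close> intact, so it is applied before that product is expanded.\<close>
      unfolding ax3 unfolding tu uv
      by (simp add: linext_add linext_lc_scale ax [unfolded uv] lc_scale_add algebra_simps)
    also have "\<dots> = linext (star q t) (star q u v)"
      unfolding linext_fun_add [symmetric] linext_fun_scale [symmetric]
      using valid(2) less.prems tuv by (intro linext_cong) (simp add: star_nonleaf)
    finally show ?thesis .
  qed
qed

lemma bilinext_in_DT:
  assumes "p \<in> DT" "r \<in> DT"
    and "\<And>t s. valid_tree t \<Longrightarrow> valid_tree s \<Longrightarrow> t \<noteq> Leaf \<Longrightarrow> s \<noteq> Leaf \<Longrightarrow> g t s \<in> DT"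
  shows "bilinext g p r \<in> DT"
proof -
  have "valid_tree t \<and> t \<noteq> Leaf" if "t \<in> Poly_Mapping.keys p \<union> Poly_Mapping.keys r" for t
    using assms(1,2) that by (auto simp: DT_def)
  then show ?thesis
    unfolding bilinext_eq_linext by (intro linext_in_DT assms(3)) auto
qed

lemma bilinear_on_bilinext:
  assumes "\<And>t s. valid_tree t \<Longrightarrow> valid_tree s \<Longrightarrow> t \<noteq> Leaf \<Longrightarrow> s \<noteq> Leaf \<Longrightarrow> g t s \<in> DT"
  shows "bilinear_on lc_scale DT (bilinext g)"
  unfolding bilinear_on_def bilinext_add_left bilinext_add_right bilinext_scale_left bilinext_scale_right
  using assms by (simp add: bilinext_in_DT)

lemma bilinext_star:
  assumes "p \<in> DT" "r \<in> DT"
  shows "DT_prec q p r + DT_succ q p r + lc_scale q (DT_bull q p r) = bilinext (star q) p r"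
  unfolding DT_prec_def DT_succ_def DT_bull_def bilinext_eq_linext
    linext_fun_add [symmetric] linext_fun_scale [symmetric]
  using assms by (intro linext_cong) (auto simp: DT_def star_nonleaf)

lemma q_tridendriform_DT:
  fixes q :: "'k::comm_ring_1"
  shows "q_tridendriform lc_scale (DT :: ('y, 'k) lc set) q (DT_prec q) (DT_succ q) (DT_bull q)"
proof -
  have bilinear: "bilinear_on lc_scale DT (DT_prec q)" "bilinear_on lc_scale DT (DT_succ q)"
      "bilinear_on lc_scale DT (DT_bull q)"
    unfolding DT_prec_def DT_succ_def DT_bull_def
    by (intro bilinear_on_bilinext precb_in_DT succb_in_DT bullb_in_DT; assumption)+
  have axioms:
      "DT_prec q (DT_prec q a b) c = DT_prec q a (bilinext (star q) b c)"
      "DT_prec q (DT_succ q a b) c = DT_succ q a (DT_prec q b c)"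
      "DT_succ q (bilinext (star q) a b) c = DT_succ q a (DT_succ q b c)"
      "DT_bull q (DT_succ q a b) c = DT_succ q a (DT_bull q b c)"
      "DT_bull q (DT_prec q a b) c = DT_bull q a (DT_succ q b c)"
      "DT_prec q (DT_bull q a b) c = DT_bull q a (DT_prec q b c)"
      "DT_bull q (DT_bull q a b) c = DT_bull q a (DT_bull q b c)"
    if "a \<in> DT" "b \<in> DT" "c \<in> DT" for a b c :: "('y, 'k) lc"
    unfolding DT_prec_def DT_succ_def DT_bull_def
    by (rule bilinext_reassoc, rule tridendriform_basis_of_star_assoc [OF _ _ _ _ _ _ star_assoc];
        use that in \<open>auto simp: DT_def\<close>)+
  show ?thesis
    unfolding q_tridendriform_def Let_def
    using module_lc_scale bilinear axioms DT_zero
    by (simp add: bilinext_star DT_add DT_scale)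
qed

section \<open>Evaluation of trees in a tridendriform algebra\<close>

locale tridendriform =
  fixes sc :: "'k::comm_ring_1 \<Rightarrow> 'b::ab_group_add \<Rightarrow> 'b" and A :: "'b set" and q :: 'k
    and pr su bu :: "'b \<Rightarrow> 'b \<Rightarrow> 'b"
  assumes tridendriform: "q_tridendriform sc A q pr su bu"
begin

sublocale module sc
  using tridendriform by (simp add: q_tridendriform_def)

definition st :: "'b \<Rightarrow> 'b \<Rightarrow> 'b" where
  "st a b = pr a b + su a b + sc q (bu a b)"

lemma zero_in [simp]: "0 \<in> A"
  and add_in [simp]: "a \<in> A \<Longrightarrow> b \<in> A \<Longrightarrow> a + b \<in> A"
  and sc_in [simp]: "a \<in> A \<Longrightarrow> sc c a \<in> A"
  using tridendriform by (simp_all add: q_tridendriform_def)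

lemma bilinear: "bilinear_on sc A pr" "bilinear_on sc A su" "bilinear_on sc A bu"
  using tridendriform by (simp_all add: q_tridendriform_def)

lemma pr_in [simp]: "a \<in> A \<Longrightarrow> b \<in> A \<Longrightarrow> pr a b \<in> A"
  and su_in [simp]: "a \<in> A \<Longrightarrow> b \<in> A \<Longrightarrow> su a b \<in> A"
  and bu_in [simp]: "a \<in> A \<Longrightarrow> b \<in> A \<Longrightarrow> bu a b \<in> A"
  using bilinear by (simp_all add: bilinear_on_def)

lemma lext_in_A: "(\<And>t. t \<in> Poly_Mapping.keys p \<Longrightarrow> g t \<in> A) \<Longrightarrow> lext sc g p \<in> A"
  by (rule lext_in) simp_all

lemma
  assumes "a \<in> A" "b \<in> A" "c \<in> A"
  shows prec_prec: "pr (pr a b) c = pr a (st b c)"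
    and succ_prec: "pr (su a b) c = su a (pr b c)"
    and succ_succ: "su a (su b c) = su (st a b) c"
    and succ_bull: "bu (su a b) c = su a (bu b c)"
    and prec_bull: "bu (pr a b) c = bu a (su b c)"
    and bull_prec: "pr (bu a b) c = bu a (pr b c)"
    and bull_bull: "bu (bu a b) c = bu a (bu b c)"
  using tridendriform assms by (simp_all add: q_tridendriform_def Let_def st_def)

lemma
  assumes "bilinear_on sc A m" "\<And>t. t \<in> Poly_Mapping.keys p \<Longrightarrow> g t \<in> A" "b \<in> A"
  shows bilinear_lext_left: "m (lext sc g p) b = lext sc (\<lambda>t. m (g t) b) p"
    and bilinear_lext_right: "m b (lext sc g p) = lext sc (\<lambda>t. m b (g t)) p"
proof -
  let ?s = "\<lambda>h I. \<Sum>t\<in>I. sc (Poly_Mapping.lookup p t) (h t)"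
  have m: "a \<in> A \<Longrightarrow> c \<in> A \<Longrightarrow> m (a + c) b = m a b + m c b \<and> m b (a + c) = m b a + m b c"
      "a \<in> A \<Longrightarrow> m (sc k a) b = sc k (m a b) \<and> m b (sc k a) = sc k (m b a)" for a c k
    using assms(1,3) by (auto simp: bilinear_on_def)
  have m0: "m 0 b = 0 \<and> m b 0 = 0"
    using m(1) [of 0 0] by simp
  \<comment> \<open>Bilinearity is available on \<open>A\<close> only, so the induction also carries
    membership of the partial sums in \<open>A\<close>.\<close>
  have "finite I \<Longrightarrow> I \<subseteq> Poly_Mapping.keys p \<Longrightarrow>
      ?s g I \<in> A \<and> m (?s g I) b = ?s (\<lambda>t. m (g t) b) I \<and> m b (?s g I) = ?s (\<lambda>t. m b (g t)) I" for I
    by (induction I rule: finite_induct) (use assms(2) in \<open>auto simp: m m0\<close>)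
  then show "m (lext sc g p) b = lext sc (\<lambda>t. m (g t) b) p"
      "m b (lext sc g p) = lext sc (\<lambda>t. m b (g t)) p"
    by (simp_all add: lext_def)
qed

end

text \<open>The recursion splits off the first decoration with the first child. Children equal to
  \<open>Leaf\<close> are skipped, as they act as units; \<open>Leaf\<close> itself and ill-formed
  trees have no value in the algebra and end in the default.\<close>

fun eval_tree :: "('b \<Rightarrow> 'b \<Rightarrow> 'b) \<Rightarrow> ('b \<Rightarrow> 'b \<Rightarrow> 'b) \<Rightarrow> ('b \<Rightarrow> 'b \<Rightarrow> 'b) \<Rightarrow> ('y \<Rightarrow> 'b) \<Rightarrow> 'y tree \<Rightarrow> 'b" where
  "eval_tree pr su bu f (Node [y] [t, u]) =
     (let x = if t = Leaf then f y else su (eval_tree pr su bu f t) (f y)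
      in if u = Leaf then x else pr x (eval_tree pr su bu f u))"
| "eval_tree pr su bu f (Node (y # y' # ys) (t # ts)) =
     bu (if t = Leaf then f y else su (eval_tree pr su bu f t) (f y))
        (eval_tree pr su bu f (Node (y' # ys) ts))"
| "eval_tree pr su bu f t = undefined"

locale tridendriform_generators = tridendriform sc A q pr su bu
  for sc :: "'k::comm_ring_1 \<Rightarrow> 'b::ab_group_add \<Rightarrow> 'b" and A q pr su bu +
  fixes f :: "'y \<Rightarrow> 'b"
  assumes f_in [simp]: "f y \<in> A"
begin

abbreviation ev :: "'y tree \<Rightarrow> 'b" where
  "ev \<equiv> eval_tree pr su bu f"

text \<open>With \<open>ract\<close>, the actions by \<open>\<succ>\<close> from the left and
  \<open>\<prec>\<close> from the right, extended by the identity for \<open>Leaf\<close> in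
  accordance with the conventions for \<open>|\<close>.\<close>

definition lact :: "'y tree \<Rightarrow> 'b \<Rightarrow> 'b" where
  "lact t x = (if t = Leaf then x else su (ev t) x)"

definition ract :: "'b \<Rightarrow> 'y tree \<Rightarrow> 'b" where
  "ract x t = (if t = Leaf then x else pr x (ev t))"

lemma act_Leaf [simp]: "lact Leaf x = x" "ract x Leaf = x"
  by (simp_all add: lact_def ract_def)

lemma ev_single [simp]: "ev (Node [y] [t, u]) = ract (lact t (f y)) u"
  by (simp add: lact_def ract_def Let_def)

lemma ev_Cons [simp]: "ys \<noteq> [] \<Longrightarrow> ev (Node (y # ys) (t # ts)) = bu (lact t (f y)) (ev (Node ys ts))"
  by (cases ys) (simp_all add: lact_def)

declare eval_tree.simps [simp del]

lemma ev_in: "valid_tree t \<Longrightarrow> t \<noteq> Leaf \<Longrightarrow> ev t \<in> A"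
proof (induction "size t" arbitrary: t rule: less_induct)
  case less
  obtain y ys u us where t: "t = Node (y # ys) (u # us)" "length us = Suc (length ys)"
      "valid_tree u" "\<forall>v\<in>set us. valid_tree v"
    using less.prems by (cases t rule: valid_tree.cases) (auto simp: neq_Nil_conv length_Suc_conv)
  have u: "u \<noteq> Leaf \<Longrightarrow> ev u \<in> A"
    using less.hyps [of u] t by simp
  show ?case
  proof (cases ys)
    case Nil
    then obtain v where v: "us = [v]"
      using t by (auto simp: length_Suc_conv)
    have "v \<noteq> Leaf \<Longrightarrow> ev v \<in> A"
      using less.hyps [of v] t v by simp
    with u v Nil t(1) show ?thesis
      by (simp add: lact_def ract_def)
  next
    case (Cons y' ys')
    have "ev (Node ys us) \<in> A"
      using less.hyps [of "Node ys us"] t Cons by simp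
    with u Cons t(1) show ?thesis
      by (simp add: lact_def)
  qed
qed

lemma lact_in [simp]: "valid_tree t \<Longrightarrow> x \<in> A \<Longrightarrow> lact t x \<in> A"
  and ract_in [simp]: "valid_tree t \<Longrightarrow> x \<in> A \<Longrightarrow> ract x t \<in> A"
  by (simp_all add: lact_def ract_def ev_in)

lemma
  assumes "valid_tree t" "a \<in> A" "b \<in> A"
  shows ract_bull: "ract (bu a b) t = bu a (ract b t)"
    and lact_bull: "lact t (bu a b) = bu (lact t a) b"
    and bull_middle: "bu (ract a t) b = bu a (lact t b)"
  using assms by (simp_all add: lact_def ract_def ev_in bull_prec succ_bull prec_bull)

lemma lact_ract:
  "valid_tree t \<Longrightarrow> valid_tree u \<Longrightarrow> x \<in> A \<Longrightarrow> ract (lact t x) u = lact t (ract x u)"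
  by (simp add: lact_def ract_def ev_in succ_prec)

lemma ev_Node_in:
  "ys \<noteq> [] \<Longrightarrow> length ts = Suc (length ys) \<Longrightarrow> \<forall>t\<in>set ts. valid_tree t \<Longrightarrow> ev (Node ys ts) \<in> A"
  by (rule ev_in) simp_all

text \<open>Only the last factor of the iterated \<open>\<bullet>\<close> contains the last child,
  and \<open>(a \<bullet> b) \<prec> c = a \<bullet> (b \<prec> c)\<close> moves the action of
  \<open>w\<close> out of it.\<close>

lemma ev_last:
  assumes "ys \<noteq> []" "length ts = length ys" "\<forall>t\<in>set ts. valid_tree t" "valid_tree w"
  shows "ev (Node ys (ts @ [w])) = ract (ev (Node ys (ts @ [Leaf]))) w"
  using assms
proof (induction ys arbitrary: ts)
  case (Cons y ys)
  then obtain t ts' where ts: "ts = t # ts'"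
    by (cases ts) auto
  show ?case
  proof (cases "ys = []")
    case True
    with Cons.prems ts show ?thesis by simp
  next
    case False
    with Cons ts show ?thesis
      by (simp add: ract_bull ev_Node_in)
  qed
qed simp

text \<open>The first child occurs in the head factor only, so one use of
  \<open>(a \<succ> b) \<bullet> c = a \<succ> (b \<bullet> c)\<close> suffices; for a single
  decoration \<open>\<succ>\<close> passes \<open>\<prec>\<close> instead.\<close>

lemma ev_first:
  assumes "ys \<noteq> []" "length ts = length ys" "\<forall>t\<in>set ts. valid_tree t" "valid_tree w"
  shows "ev (Node ys (w # ts)) = lact w (ev (Node ys (Leaf # ts)))"
proof -
  obtain y ys' where ys: "ys = y # ys'"
    using assms(1) by (cases ys) auto
  show ?thesis
  proof (cases "ys' = []")
    case True
    with assms ys obtain v where "ts = [v]"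
      by (auto simp: length_Suc_conv)
    with True assms ys show ?thesis
      by (simp add: lact_ract)
  next
    case False
    with assms ys show ?thesis
      by (simp add: lact_bull ev_Node_in)
  qed
qed

text \<open>Associativity of \<open>\<bullet>\<close> allows the root to be cut at any child
  \<open>w\<close>, which goes to the right block while the left block ends in a leaf.\<close>

lemma ev_append:
  assumes "xs \<noteq> []" "length ts = length xs" "ys \<noteq> []" "length ss = length ys"
    "\<forall>t\<in>set ts. valid_tree t" "\<forall>s\<in>set ss. valid_tree s" "valid_tree w"
  shows "ev (Node (xs @ ys) (ts @ w # ss)) = bu (ev (Node xs (ts @ [Leaf]))) (ev (Node ys (w # ss)))"
  using assms
proof (induction xs arbitrary: ts)
  case (Cons x xs)
  then obtain t ts' where ts: "ts = t # ts'"
    by (cases ts) auto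
  show ?case
  proof (cases "xs = []")
    case True
    with Cons.prems ts show ?thesis by simp
  next
    case False
    with Cons ts show ?thesis
      by (simp add: bull_bull ev_Node_in)
  qed
qed simp

text \<open>The axioms for \<open>(a \<prec> b) \<prec> c\<close> and
  \<open>(a \<star> b) \<succ> c\<close> say that a \<open>\<star>\<close> product acts as the
  composite of its factors.\<close>

lemma ev_star_of_hom:
  assumes "valid_tree t" "valid_tree s" "t \<noteq> Leaf" "s \<noteq> Leaf" "x \<in> A"
    and "lext sc ev (precb q t s) = pr (ev t) (ev s)"
    and "lext sc ev (succb q t s) = su (ev t) (ev s)"
    and "lext sc ev (bullb q t s) = bu (ev t) (ev s)"
  shows "lext sc (\<lambda>w. lact w x) (star q t s) = lact t (lact s x)"
    and "lext sc (ract x) (star q t s) = ract (ract x t) s"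
proof -
  have keys: "w \<in> Poly_Mapping.keys (star q t s) \<Longrightarrow> valid_tree w \<and> w \<noteq> Leaf" for w
    using star_in_DT [OF assms(1-4), of q] by (auto simp: DT_def)
  have star: "lext sc ev (star q t s) = st (ev t) (ev s)"
    using assms by (simp add: star_nonleaf st_def lext_add lext_lc_scale)
  have "lext sc (\<lambda>w. lact w x) (star q t s) = lext sc (\<lambda>w. su (ev w) x) (star q t s)"
    using keys by (intro lext_cong) (simp add: lact_def)
  also have "\<dots> = su (lext sc ev (star q t s)) x"
    using keys assms by (simp add: bilinear_lext_left [OF bilinear(2)] ev_in)
  also have "\<dots> = lact t (lact s x)"
    using assms by (simp add: star lact_def ev_in succ_succ)
  finally show "lext sc (\<lambda>w. lact w x) (star q t s) = lact t (lact s x)" .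
  have "lext sc (ract x) (star q t s) = lext sc (\<lambda>w. pr x (ev w)) (star q t s)"
    using keys by (intro lext_cong) (simp add: ract_def)
  also have "\<dots> = pr x (lext sc ev (star q t s))"
    using keys assms by (simp add: bilinear_lext_right [OF bilinear(1)] ev_in)
  also have "\<dots> = ract (ract x t) s"
    using assms by (simp add: star ract_def ev_in prec_prec)
  finally show "lext sc (ract x) (star q t s) = ract (ract x t) s" .
qed

lemma lext_graft: "lext sc g (graft ys pre post p) = lext sc (\<lambda>u. g (Node ys (pre @ u # post))) p"
  by (simp add: graft_def lext_linext)

text \<open>Converse to \<open>ev_star_of_hom\<close>: each product of \<open>t\<close> and
  \<open>s\<close> grafts a smaller \<open>star\<close> product, and evaluating it requires only the
  action of that smaller product.\<close>

lemma ev_hom_of_star: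
  assumes valid: "valid_tree t" "valid_tree s" "t \<noteq> Leaf" "s \<noteq> Leaf"
    and star: "\<And>t' s' x. valid_tree t' \<Longrightarrow> valid_tree s' \<Longrightarrow> x \<in> A \<Longrightarrow> size t' + size s' < size t + size s \<Longrightarrow>
      lext sc (\<lambda>w. lact w x) (star q t' s') = lact t' (lact s' x) \<and>
      lext sc (ract x) (star q t' s') = ract (ract x t') s'"
  shows "lext sc ev (precb q t s) = pr (ev t) (ev s)"
    and "lext sc ev (succb q t s) = su (ev t) (ev s)"
    and "lext sc ev (bullb q t s) = bu (ev t) (ev s)"
proof -
  obtain xs t1 tm t2 where t': "t = Node xs (t1 # tm @ [t2])" "xs \<noteq> []" "length xs = Suc (length tm)"
      "valid_tree t1" "\<forall>s\<in>set tm. valid_tree s" and t2: "valid_tree t2"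
    by (rule valid_tree_cases [OF valid(1,3)])
  define ts where "ts = t1 # tm"
  have t: "t = Node xs (ts @ [t2])" "xs \<noteq> []" "length ts = length xs" "\<forall>s\<in>set ts. valid_tree s"
    using t' by (simp_all add: ts_def)
  obtain ys s1 sm s2 where s': "s = Node ys (s1 # sm @ [s2])" "ys \<noteq> []" "length ys = Suc (length sm)"
      and s1: "valid_tree s1" and s'': "\<forall>s\<in>set sm. valid_tree s" "valid_tree s2"
    by (rule valid_tree_cases [OF valid(2,4)])
  define ss where "ss = sm @ [s2]"
  have s: "s = Node ys (s1 # ss)" "ys \<noteq> []" "length ss = length ys" "\<forall>s\<in>set ss. valid_tree s"
    using s' s'' by (auto simp: ss_def)
  \<comment> \<open>\<open>a\<close> and \<open>b\<close> are the values of \<open>t\<close> without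
    its last child and of \<open>s\<close> without its first child; those children then act on
    \<open>a\<close> and \<open>b\<close>.\<close>
  define a where "a = ev (Node xs (ts @ [Leaf]))"
  define b where "b = ev (Node ys (Leaf # ss))"
  have ab: "a \<in> A" "b \<in> A"
    unfolding a_def b_def using t s by (auto intro!: ev_Node_in)
  have sizes: "size t2 < size t" "size s1 < size s"
    using t(1) s(1) by simp_all
  have ev_t: "ev (Node xs (ts @ [w])) = ract a w" if "valid_tree w" for w
    unfolding a_def using t that by (intro ev_last)
  have ev_s: "ev (Node ys (w # ss)) = lact w b" if "valid_tree w" for w
    unfolding b_def using s that by (intro ev_first)
  have ev_ts: "ev (Node (xs @ ys) (ts @ w # ss)) = bu a (lact w b)" if "valid_tree w" for w
    unfolding a_def ev_s [OF that, symmetric] using t s that by (intro ev_append)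
  have evt: "ev t = ract a t2" and evs: "ev s = lact s1 b"
    unfolding t(1) s(1) by (simp_all add: ev_t ev_s t2 s1)
  have "lext sc ev (precb q t s) = lext sc (ract a) (star q t2 s)"
    unfolding t(1) precb_snoc lext_graft
    using valid_star [OF t2 valid(2), of q] by (intro lext_cong) (simp add: ev_t)
  also have "\<dots> = pr (ev t) (ev s)"
    using star [of t2 s a] sizes t2 valid ab by (simp add: evt ract_def)
  finally show "lext sc ev (precb q t s) = pr (ev t) (ev s)" .
  have "lext sc ev (succb q t s) = lext sc (\<lambda>w. lact w b) (star q t s1)"
    unfolding s(1) succb_Cons lext_graft
    using valid_star [OF valid(1) s1, of q] by (intro lext_cong) (simp add: ev_s)
  also have "\<dots> = su (ev t) (ev s)"
    using star [of t s1 b] sizes s1 valid ab by (simp add: evs lact_def)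
  finally show "lext sc ev (succb q t s) = su (ev t) (ev s)" .
  have keys: "w \<in> Poly_Mapping.keys (star q t2 s1) \<Longrightarrow> valid_tree w" for w
    using valid_star [OF t2 s1, of q] by simp
  have "lext sc ev (bullb q t s) = lext sc (\<lambda>w. bu a (lact w b)) (star q t2 s1)"
    unfolding s(1) t(1) bullb_snoc_Cons lext_graft
    using keys by (intro lext_cong) (simp add: ev_ts)
  also have "\<dots> = bu a (lext sc (\<lambda>w. lact w b) (star q t2 s1))"
    using keys ab by (simp add: bilinear_lext_right [OF bilinear(3)])
  also have "\<dots> = bu a (lact t2 (lact s1 b))"
    using star [of t2 s1 b] sizes t2 s1 ab by simp
  also have "\<dots> = bu (ev t) (ev s)"
    unfolding evt evs using t2 s1 ab by (simp add: bull_middle)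
  finally show "lext sc ev (bullb q t s) = bu (ev t) (ev s)" .
qed

text \<open>Induction on total size closes the loop between \<open>ev_hom_of_star\<close> and
  \<open>ev_star_of_hom\<close>. The element \<open>x\<close> must vary, since the smaller instances
  are used at \<open>a\<close> and \<open>b\<close>.\<close>

lemma ev_star:
  assumes "valid_tree t" "valid_tree s" "x \<in> A"
  shows "lext sc (\<lambda>w. lact w x) (star q t s) = lact t (lact s x) \<and>
    lext sc (ract x) (star q t s) = ract (ract x t) s"
  using assms
proof (induction "size t + size s" arbitrary: t s x rule: less_induct)
  case less
  show ?case
  proof (cases "t = Leaf \<or> s = Leaf")
    case True
    then show ?thesis by auto
  next
    case False
    then have nonleaf: "t \<noteq> Leaf" "s \<noteq> Leaf"
      by auto
    have IH: "lext sc (\<lambda>w. lact w x) (star q t' s') = lact t' (lact s' x) \<and>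
        lext sc (ract x) (star q t' s') = ract (ract x t') s'"
      if "valid_tree t'" "valid_tree s'" "x \<in> A" "size t' + size s' < size t + size s"
      for t' s' :: "'y tree" and x
      using less.hyps that by blast
    note hom = ev_hom_of_star [OF less.prems(1,2) nonleaf]
    have "lext sc ev (precb q t s) = pr (ev t) (ev s)" "lext sc ev (succb q t s) = su (ev t) (ev s)"
        "lext sc ev (bullb q t s) = bu (ev t) (ev s)"
      by (rule hom; rule IH; assumption)+
    from ev_star_of_hom [OF less.prems(1,2) nonleaf less.prems(3) this]
    show ?thesis ..
  qed
qed

lemma ev_hom:
  assumes "valid_tree t" "valid_tree s" "t \<noteq> Leaf" "s \<noteq> Leaf"
  shows "lext sc ev (precb q t s) = pr (ev t) (ev s)"
    and "lext sc ev (succb q t s) = su (ev t) (ev s)"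
    and "lext sc ev (bullb q t s) = bu (ev t) (ev s)"
  by (rule ev_hom_of_star [OF assms]; rule ev_star; assumption)+

lemma lext_ev_bilinext:
  assumes "bilinear_on sc A m" "p \<in> DT" "r \<in> DT"
    and "\<And>t s. valid_tree t \<Longrightarrow> valid_tree s \<Longrightarrow> t \<noteq> Leaf \<Longrightarrow> s \<noteq> Leaf \<Longrightarrow> lext sc ev (g t s) = m (ev t) (ev s)"
  shows "lext sc ev (bilinext g p r) = m (lext sc ev p) (lext sc ev r)"
proof -
  have keys: "t \<in> Poly_Mapping.keys p \<union> Poly_Mapping.keys r \<Longrightarrow> valid_tree t \<and> t \<noteq> Leaf" for t
    using assms(2,3) by (auto simp: DT_def)
  then have in_A: "t \<in> Poly_Mapping.keys p \<union> Poly_Mapping.keys r \<Longrightarrow> ev t \<in> A" for t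
    by (simp add: ev_in)
  have "lext sc ev (bilinext g p r) = lext sc (\<lambda>t. lext sc (\<lambda>s. m (ev t) (ev s)) r) p"
    unfolding bilinext_eq_linext lext_linext
    using keys by (intro lext_cong assms(4)) auto
  also have "\<dots> = lext sc (\<lambda>t. m (ev t) (lext sc ev r)) p"
    using in_A by (intro lext_cong) (simp add: bilinear_lext_right [OF assms(1)])
  also have "\<dots> = m (lext sc ev p) (lext sc ev r)"
    using in_A by (simp add: bilinear_lext_left [OF assms(1)] lext_in_A)
  finally show ?thesis .
qed

end

section \<open>Homomorphisms out of \<open>DT\<close> over an arbitrary decoration set\<close>

definition corolla :: "'y \<Rightarrow> 'y tree" where
  "corolla y = Node [y] [Leaf, Leaf]"

lemma valid_corolla [simp]: "valid_tree (corolla y)" "corolla y \<noteq> Leaf"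
  by (simp_all add: corolla_def)

lemma
  assumes "t \<in> DT" "s \<in> DT"
  shows DT_prec_in: "DT_prec q t s \<in> DT"
    and DT_succ_in: "DT_succ q t s \<in> DT"
    and DT_bull_in: "DT_bull q t s \<in> DT"
  using q_tridendriform_DT [of q] assms by (auto simp: q_tridendriform_def bilinear_on_def)

lemma DT_operations_basis [simp]:
  "DT_prec q (basis t) (basis s) = precb q t s"
  "DT_succ q (basis t) (basis s) = succb q t s"
  "DT_bull q (basis t) (basis s) = bullb q t s"
  by (simp_all add: DT_prec_def DT_succ_def DT_bull_def)

text \<open>This and the next two identities generate all valid trees other than \<open>Leaf\<close>
  from corollas, in the same recursion as \<open>eval_tree\<close>.\<close>

lemma basis_single_left: "basis (Node [y] [t, Leaf]) = succb q t (corolla y)"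
  by (simp add: corolla_def)

lemma basis_single: "basis (Node [y] [t, u]) = precb q (Node [y] [t, Leaf]) u"
  using precb_snoc [of q "[y]" "[t]" Leaf u] by simp

lemma basis_Cons:
  "ts \<noteq> [] \<Longrightarrow> basis (Node (y # ys) (t # ts)) = bullb q (Node [y] [t, Leaf]) (Node ys ts)"
  using bullb_snoc_Cons [of q "[y]" "[t]" Leaf ys "hd ts" "tl ts"] by simp

context tridendriform
begin

definition DT_hom :: "(('y, 'k) lc \<Rightarrow> 'b) \<Rightarrow> bool" where
  "DT_hom g \<longleftrightarrow> linear_on lc_scale DT sc A g \<and>
     (\<forall>a\<in>DT. \<forall>b\<in>DT. g (DT_prec q a b) = pr (g a) (g b) \<and> g (DT_succ q a b) = su (g a) (g b)
        \<and> g (DT_bull q a b) = bu (g a) (g b))"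

text \<open>Linearity of \<open>g\<close> is known on \<open>DT\<close> only, so \<open>p\<close> is
  rebuilt from its basis terms while the partial sums are kept in \<open>DT\<close>.\<close>

lemma linear_on_eq_lext:
  assumes "linear_on lc_scale DT sc A g" "p \<in> DT"
  shows "g p = lext sc (\<lambda>t. g (basis t)) p"
proof -
  let ?s = "\<lambda>I. \<Sum>t\<in>I. lc_scale (Poly_Mapping.lookup p t) (basis t)"
  have g: "g (a + b) = g a + g b" "g (lc_scale c a) = sc c (g a)" if "a \<in> DT" "b \<in> DT" for a b c
    using assms(1) that by (auto simp: linear_on_def)
  have g0: "g 0 = 0"
    using g(1) [of 0 0] DT_zero by simp
  have basis: "t \<in> Poly_Mapping.keys p \<Longrightarrow> basis t \<in> DT" for t
    using assms(2) by (intro basis_in_DT) (auto simp: DT_def)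
  have "finite I \<Longrightarrow> I \<subseteq> Poly_Mapping.keys p \<Longrightarrow>
      ?s I \<in> DT \<and> g (?s I) = (\<Sum>t\<in>I. sc (Poly_Mapping.lookup p t) (g (basis t)))" for I
    by (induction I rule: finite_induct) (auto simp: g g0 basis DT_zero DT_add DT_scale)
  then have "g (linext basis p) = lext sc (\<lambda>t. g (basis t)) p"
    by (simp add: linext_def lext_def)
  then show ?thesis
    by simp
qed

end

context tridendriform_generators
begin

lemma ev_corolla [simp]: "ev (corolla y) = f y"
  by (simp add: corolla_def)

lemma DT_hom_lext_ev: "DT_hom (lext sc ev)"
  unfolding DT_hom_def linear_on_def DT_prec_def DT_succ_def DT_bull_def
proof (intro conjI ballI allI)
  show "a \<in> DT \<Longrightarrow> lext sc ev a \<in> A" for a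
    by (rule lext_in_A) (auto simp: DT_def intro: ev_in)
qed (auto simp: lext_add lext_lc_scale intro!: lext_ev_bilinext bilinear ev_hom)

text \<open>Uniqueness on trees: a homomorphism turns the decomposition of a tree into corollas and
  smaller trees into the recursion of \<open>eval_tree\<close>.\<close>

lemma DT_hom_basis:
  assumes "DT_hom g" "\<And>y. g (basis (corolla y)) = f y" "valid_tree t" "t \<noteq> Leaf"
  shows "g (basis t) = ev t"
  using assms(3,4)
proof (induction "size t" arbitrary: t rule: less_induct)
  case less
  have hom: "g (precb q t s) = pr (g (basis t)) (g (basis s))"
      "g (succb q t s) = su (g (basis t)) (g (basis s))"
      "g (bullb q t s) = bu (g (basis t)) (g (basis s))"
    if "valid_tree t" "valid_tree s" "t \<noteq> Leaf" "s \<noteq> Leaf" for t s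
    using assms(1) basis_in_DT [OF that(1,3)] basis_in_DT [OF that(2,4)]
    unfolding DT_hom_def DT_operations_basis [symmetric] by blast+
  obtain y ys u us where t: "t = Node (y # ys) (u # us)" "length us = Suc (length ys)"
      "valid_tree u" "\<forall>v\<in>set us. valid_tree v"
    using less.prems by (cases t rule: valid_tree.cases) (auto simp: neq_Nil_conv length_Suc_conv)
  have left: "g (basis (Node [y] [u, Leaf])) = lact u (f y)"
  proof (cases "u = Leaf")
    case True
    then show ?thesis
      using assms(2) [of y] by (simp add: corolla_def)
  next
    case False
    then have "g (basis u) = ev u"
      using less.hyps [of u] t by simp
    with False t assms(2) show ?thesis
      by (simp add: basis_single_left [of _ _ q] hom lact_def del: succb_Cons)
  qed
  show ?case
  proof (cases ys)
    case Nil
    then obtain v where v: "us = [v]" "valid_tree v"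
      using t by (auto simp: length_Suc_conv)
    show ?thesis
    proof (cases "v = Leaf")
      case True
      with Nil t(1) v left show ?thesis by simp
    next
      case False
      then have "g (basis v) = ev v"
        using less.hyps [of v] t v by simp
      with False t v Nil left show ?thesis
        by (simp add: basis_single [of _ _ v q] hom ract_def)
    qed
  next
    case (Cons y' ys')
    have "g (basis (Node ys us)) = ev (Node ys us)"
      using less.hyps [of "Node ys us"] t Cons by simp
    moreover have "us \<noteq> []"
      using t(2) by auto
    ultimately show ?thesis
      using t left Cons by (simp add: basis_Cons [of us _ _ _ q] hom)
  qed
qed

lemma DT_hom_unique:
  assumes "DT_hom g" "\<And>y. g (basis (corolla y)) = f y" "p \<in> DT"
  shows "g p = lext sc ev p"
proof -
  have "g p = lext sc (\<lambda>t. g (basis t)) p"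
    using assms by (intro linear_on_eq_lext) (simp_all add: DT_hom_def)
  also have "\<dots> = lext sc ev p"
    using assms by (intro lext_cong DT_hom_basis) (auto simp: DT_def)
  finally show ?thesis .
qed

end

section \<open>Derivations as homomorphisms\<close>

text \<open>Elements of \<open>A[\<epsilon>]\<close> with \<open>\<epsilon>\<^sup>2 = \<lambda> \<epsilon>\<close>, the pair \<open>(a, b)\<close> standing for \<open>a + b \<epsilon>\<close>. A linear map
  \<open>d\<close> is a derivation of weight \<open>\<lambda>\<close> iff \<open>a \<mapsto> a + d(a) \<epsilon>\<close> is multiplicative.\<close>

definition eps_scale :: "('k \<Rightarrow> 'b \<Rightarrow> 'b) \<Rightarrow> 'k \<Rightarrow> 'b \<times> 'b \<Rightarrow> 'b \<times> 'b" where
  "eps_scale sc c x = (sc c (fst x), sc c (snd x))"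

definition eps_op :: "('k \<Rightarrow> 'b::ab_group_add \<Rightarrow> 'b) \<Rightarrow> 'k \<Rightarrow> ('b \<Rightarrow> 'b \<Rightarrow> 'b) \<Rightarrow> 'b \<times> 'b \<Rightarrow> 'b \<times> 'b \<Rightarrow> 'b \<times> 'b" where
  "eps_op sc lam m x y =
     (m (fst x) (fst y), m (snd x) (fst y) + m (fst x) (snd y) + sc lam (m (snd x) (snd y)))"

lemma module_eps_scale: "module sc \<Longrightarrow> module (eps_scale sc)"
  by (auto simp: module_def eps_scale_def)

context tridendriform
begin

lemma bilinear_on_simps:
  assumes "bilinear_on sc A m" "a \<in> A" "b \<in> A" "c \<in> A"
  shows "m a b \<in> A" "m (a + b) c = m a c + m b c" "m a (b + c) = m a b + m a c"
    "m (sc k a) b = sc k (m a b)" "m a (sc k b) = sc k (m a b)"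
  using assms by (auto simp: bilinear_on_def)

lemma bilinear_on_eps_op:
  assumes "bilinear_on sc A m"
  shows "bilinear_on (eps_scale sc) (A \<times> A) (eps_op sc lam m)"
  unfolding bilinear_on_def
  by (auto simp: eps_op_def eps_scale_def bilinear_on_simps [OF assms]
    scale_left_commute algebra_simps)

text \<open>Extension of scalars preserves trilinear identities: each coefficient is a sum of values
  of the two sides at components of \<open>x\<close>, \<open>y\<close> and \<open>z\<close>. The
  operations are independent so that all seven axioms are covered.\<close>

lemma eps_op_assoc:
  assumes "bilinear_on sc A m1" "bilinear_on sc A m2" "bilinear_on sc A m3" "bilinear_on sc A m4"
    and assoc: "\<And>a b c. a \<in> A \<Longrightarrow> b \<in> A \<Longrightarrow> c \<in> A \<Longrightarrow> m1 (m2 a b) c = m3 a (m4 b c)"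
    and "x \<in> A \<times> A" "y \<in> A \<times> A" "z \<in> A \<times> A"
  shows "eps_op sc lam m1 (eps_op sc lam m2 x y) z = eps_op sc lam m3 x (eps_op sc lam m4 y z)"
  using assms(6-8)
  by (auto simp: eps_op_def assoc algebra_simps
    bilinear_on_simps [OF assms(1)] bilinear_on_simps [OF assms(2)]
    bilinear_on_simps [OF assms(3)] bilinear_on_simps [OF assms(4)])

lemma bilinear_on_st: "bilinear_on sc A st"
  unfolding bilinear_on_def st_def
  by (auto simp: bilinear_on_simps [OF bilinear(1)] bilinear_on_simps [OF bilinear(2)]
    bilinear_on_simps [OF bilinear(3)] scale_left_commute algebra_simps)

text \<open>Identifies the \<open>\<star>\<close> product of the extended algebra with the extension
  of \<open>st\<close>, as the two axioms containing \<open>\<star>\<close> require.\<close>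

lemma eps_op_st:
  "eps_op sc lam pr x y + eps_op sc lam su x y + eps_scale sc q (eps_op sc lam bu x y)
   = eps_op sc lam st x y"
  by (simp add: eps_op_def eps_scale_def st_def scale_left_commute algebra_simps)

lemma tridendriform_eps:
  "tridendriform (eps_scale sc) (A \<times> A) q (eps_op sc lam pr) (eps_op sc lam su) (eps_op sc lam bu)"
proof -
  have "0 \<in> A \<times> A"
    by (simp add: zero_prod_def)
  moreover have "x + y \<in> A \<times> A" "eps_scale sc c x \<in> A \<times> A" if "x \<in> A \<times> A" "y \<in> A \<times> A" for x y c
    using that by (auto simp: eps_scale_def)
  moreover have "module (eps_scale sc)"
    by (intro module_eps_scale) unfold_locales
  ultimately show ?thesis
    unfolding tridendriform_def q_tridendriform_def Let_def eps_op_st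
    by (intro conjI ballI allI bilinear_on_eps_op bilinear eps_op_assoc bilinear_on_st
        prec_prec succ_prec succ_succ [symmetric] succ_bull prec_bull bull_prec bull_bull)
qed

end

section \<open>The derivation on trees\<close>

text \<open>In preorder numbering, a set of entries of a compound tree is a set \<open>S\<close> of
  positions in a leading block of length \<open>m\<close> and a set \<open>T\<close> of positions in
  the rest, renumbered from 0.\<close>

lemma sum_Pow_lessThan_add:
  "(\<Sum>S\<in>Pow {..<m + n :: nat}. h S) = (\<Sum>S\<in>Pow {..<m}. \<Sum>T\<in>Pow {..<n}. h (S \<union> (+) m ` T))"
proof -
  have split: "S \<inter> {..<m} \<union> (+) m ` {i. m + i \<in> S} = S" for S
  proof -
    have "i \<in> (+) m ` {i. m + i \<in> S}" if "i \<in> S" "\<not> i < m" for i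
      using that by (intro image_eqI [of _ _ "i - m"]) auto
    then show ?thesis by auto
  qed
  have "(\<Sum>S\<in>Pow {..<m + n}. h S) = (\<Sum>(S, T)\<in>Pow {..<m} \<times> Pow {..<n}. h (S \<union> (+) m ` T))"
  proof (rule sum.reindex_bij_witness
      [of _ "\<lambda>(S, T). S \<union> (+) m ` T" "\<lambda>S. (S \<inter> {..<m}, {i. m + i \<in> S})"], goal_cases)
    case (1 S)
    show ?case
      using split by simp
  next
    case (5 S)
    show ?case
      using split by simp
  qed auto
  then show ?thesis
    by (simp add: sum.cartesian_product)
qed

lemma card_union_shift:
  assumes "S \<subseteq> {..<m :: nat}" "finite T"
  shows "card (S \<union> (+) m ` T) = card S + card T"
proof -
  have "card (S \<union> (+) m ` T) = card S + card ((+) m ` T)"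
    using assms by (intro card_Un_disjoint) (auto intro: finite_subset)
  then show ?thesis
    by (simp add: card_image)
qed

lemma map2_upt_cong_shift:
  assumes "\<And>i. i < length ys \<Longrightarrow> f (m + i) = g (n + i)"
  shows "map2 f [m..<m + length ys] ys = map2 g [n..<n + length ys] ys"
  using assms by (intro nth_equalityI) auto

text \<open>Indices are handed out consecutively, so a subtree may be renumbered from any start if
  the indexed function is shifted along.\<close>

lemma
  shows mapi_tree_cong_shift:
      "(\<And>i. i < nent t \<Longrightarrow> f (m + i) = g (n + i)) \<Longrightarrow> mapi_tree f m t = mapi_tree g n t"
    and mapi_trees_cong_shift:
      "(\<And>i. i < sum_list (map nent ts) \<Longrightarrow> f (m + i) = g (n + i)) \<Longrightarrow> mapi_trees f m ts = mapi_trees g n ts"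
proof (induction f m t and f m ts arbitrary: n and n rule: mapi_tree_mapi_trees.induct)
  case (2 f m ys ts)
  have "map2 f [m..<m + length ys] ys = map2 g [n..<n + length ys] ys"
    using 2(2) by (intro map2_upt_cong_shift) simp
  moreover have "mapi_trees f (m + length ys) ts = mapi_trees g (n + length ys) ts"
    using 2(2) [of "length ys + _"] by (intro 2(1)) (simp add: add.assoc)
  ultimately show ?case by simp
next
  case (4 f m t ts)
  have "mapi_tree f m t = mapi_tree g n t"
    using 4(3) by (intro 4(1)) simp
  moreover have "mapi_trees f (m + nent t) ts = mapi_trees g (n + nent t) ts"
    using 4(3) [of "nent t + _"] by (intro 4(2)) (simp add: add.assoc)
  ultimately show ?case by simp
qed simp_all

section \<open>Sums over all sets of raised entries\<close>

definition raise_entry :: "nat set \<Rightarrow> nat \<Rightarrow> 'x \<times> nat \<Rightarrow> 'x \<times> nat" where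
  "raise_entry S i = (\<lambda>(x, r). if i \<in> S then (x, Suc r) else (x, r))"

lemma raise_at_eq: "raise_at S t = mapi_tree (raise_entry S) 0 t"
  by (simp add: raise_at_def raise_entry_def [abs_def])

text \<open>The first argument of \<open>G\<close> is the number of entries that are raised.\<close>

definition raised_entries :: "('x \<times> nat) list \<Rightarrow> (nat \<Rightarrow> ('x \<times> nat) list \<Rightarrow> 'b::comm_monoid_add) \<Rightarrow> 'b" where
  "raised_entries ys G =
     (\<Sum>S\<in>Pow {..<length ys}. G (card S) (map2 (raise_entry S) [0..<length ys] ys))"

text \<open>\<open>G\<close> serves as a continuation: a sum over sets of entries of a compound tree
  becomes a nested sum over its parts. Unlike in \<open>dX_basis\<close>, the empty set is
  included.\<close>

definition raised_tree :: "('x \<times> nat) tree \<Rightarrow> (nat \<Rightarrow> ('x \<times> nat) tree \<Rightarrow> 'b::comm_monoid_add) \<Rightarrow> 'b" where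
  "raised_tree t G = (\<Sum>S\<in>Pow {..<nent t}. G (card S) (raise_at S t))"

definition raised_trees :: "('x \<times> nat) tree list \<Rightarrow> (nat \<Rightarrow> ('x \<times> nat) tree list \<Rightarrow> 'b::comm_monoid_add) \<Rightarrow> 'b" where
  "raised_trees ts G =
     (\<Sum>S\<in>Pow {..<sum_list (map nent ts)}. G (card S) (mapi_trees (raise_entry S) 0 ts))"

lemma raise_entry_union_shift:
  assumes "S \<subseteq> {..<m}"
  shows "i < m \<Longrightarrow> raise_entry (S \<union> (+) m ` T) i = raise_entry S i"
    and "raise_entry (S \<union> (+) m ` T) (m + i) = raise_entry T i"
  using assms by (auto simp: raise_entry_def fun_eq_iff)

lemma raised_tree_Leaf [simp]: "raised_tree Leaf G = G 0 Leaf"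
  by (simp add: raised_tree_def raise_at_def)

lemma raised_trees_Nil [simp]: "raised_trees [] G = G 0 []"
  by (simp add: raised_trees_def)

lemma raised_entries_Nil [simp]: "raised_entries [] G = G 0 []"
  by (simp add: raised_entries_def)

lemma raised_entries_single:
  "raised_entries [(x, r)] G = G 0 [(x, r)] + G 1 [(x, Suc r)]"
  by (simp add: raised_entries_def lessThan_Suc Pow_insert raise_entry_def add.commute)

text \<open>A set of entries splits into root entries and entries of the children; the cardinalities
  add up.\<close>

lemma raised_tree_Node [simp]:
  "raised_tree (Node ys ts) G =
     raised_entries ys (\<lambda>c ys'. raised_trees ts (\<lambda>d ts'. G (c + d) (Node ys' ts')))"
  unfolding raised_tree_def raised_entries_def raised_trees_def nent.simps sum_Pow_lessThan_add
proof (intro sum.cong refl)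
  fix S T
  assume ST: "S \<in> Pow {..<length ys}" "T \<in> Pow {..<sum_list (map nent ts)}"
  have "raise_at (S \<union> (+) (length ys) ` T) (Node ys ts) =
      Node (map2 (raise_entry S) [0..<length ys] ys) (mapi_trees (raise_entry T) 0 ts)"
    using map2_upt_cong_shift [of ys "raise_entry (S \<union> (+) (length ys) ` T)" 0 "raise_entry S" 0]
      mapi_trees_cong_shift [of ts "raise_entry (S \<union> (+) (length ys) ` T)" "length ys" "raise_entry T" 0] ST
    by (simp add: raise_at_eq raise_entry_union_shift)
  moreover have "finite T"
    using ST by (auto intro: finite_subset)
  ultimately show "G (card (S \<union> (+) (length ys) ` T)) (raise_at (S \<union> (+) (length ys) ` T) (Node ys ts)) =
      G (card S + card T) (Node (map2 (raise_entry S) [0..<length ys] ys) (mapi_trees (raise_entry T) 0 ts))"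
    using ST by (simp add: card_union_shift)
qed

lemma raised_trees_Cons [simp]:
  "raised_trees (t # ts) G = raised_tree t (\<lambda>c t'. raised_trees ts (\<lambda>d ts'. G (c + d) (t' # ts')))"
  unfolding raised_tree_def raised_trees_def list.map sum_list.Cons sum_Pow_lessThan_add
proof (intro sum.cong refl)
  fix S T
  assume ST: "S \<in> Pow {..<nent t}" "T \<in> Pow {..<sum_list (map nent ts)}"
  have "mapi_trees (raise_entry (S \<union> (+) (nent t) ` T)) 0 (t # ts) =
      raise_at S t # mapi_trees (raise_entry T) 0 ts"
    using mapi_tree_cong_shift [of t "raise_entry (S \<union> (+) (nent t) ` T)" 0 "raise_entry S" 0]
      mapi_trees_cong_shift [of ts "raise_entry (S \<union> (+) (nent t) ` T)" "nent t" "raise_entry T" 0] ST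
    by (simp add: raise_at_eq raise_entry_union_shift)
  moreover have "finite T"
    using ST by (auto intro: finite_subset)
  ultimately show "G (card (S \<union> (+) (nent t) ` T)) (mapi_trees (raise_entry (S \<union> (+) (nent t) ` T)) 0 (t # ts)) =
      G (card S + card T) (raise_at S t # mapi_trees (raise_entry T) 0 ts)"
    using ST by (simp add: card_union_shift)
qed

lemma raised_entries_Cons:
  "raised_entries (y # ys) G =
     raised_entries [y] (\<lambda>c y'. raised_entries ys (\<lambda>d ys'. G (c + d) (y' @ ys')))"
proof -
  have len: "length (y # ys) = length [y] + length ys"
    by simp
  show ?thesis
    unfolding raised_entries_def len sum_Pow_lessThan_add
  proof (intro sum.cong refl)
    fix S T
    assume ST: "S \<in> Pow {..<length [y]}" "T \<in> Pow {..<length ys}"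
    let ?U = "S \<union> (+) (length [y]) ` T"
    have upt: "[0..<length [y] + length ys] = 0 # [Suc 0..<Suc 0 + length ys]" "[0..<length [y]] = [0]"
      by (simp_all add: upt_rec)
    have shift: "raise_entry ?U (Suc 0 + i) = raise_entry T (0 + i)" for i
      using raise_entry_union_shift(2) [of S "length [y]" T i] ST by simp
    have "map2 (raise_entry ?U) [Suc 0..<Suc 0 + length ys] ys = map2 (raise_entry T) [0..<length ys] ys"
      using map2_upt_cong_shift [of ys "raise_entry ?U" "Suc 0" "raise_entry T" 0, OF shift]
      by (simp del: upt_Suc)
    moreover have "raise_entry ?U 0 y = raise_entry S 0 y"
      using ST by (intro fun_cong [OF raise_entry_union_shift(1)]) simp_all
    ultimately have "map2 (raise_entry ?U) [0..<length [y] + length ys] (y # ys) =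
        map2 (raise_entry S) [0..<length [y]] [y] @ map2 (raise_entry T) [0..<length ys] ys"
      unfolding upt by (simp del: upt_Suc)
    moreover have "finite T"
      using ST by (auto intro: finite_subset)
    ultimately show "G (card ?U) (map2 (raise_entry ?U) [0..<length [y] + length ys] (y # ys)) =
        G (card S + card T)
          (map2 (raise_entry S) [0..<length [y]] [y] @ map2 (raise_entry T) [0..<length ys] ys)"
      using ST by (simp only: card_union_shift Pow_iff)
  qed
qed

text \<open>Preorder lists root entries before those of the children, whereas in
  \<open>t \<succ> y\<close> the child comes first; this exchange reconciles the two orders.\<close>

lemma raised_entries_tree_commute:
  "raised_entries ys (\<lambda>c ys'. raised_tree t (\<lambda>d t'. G c ys' d t')) =
   raised_tree t (\<lambda>d t'. raised_entries ys (\<lambda>c ys'. G c ys' d t'))"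
  unfolding raised_entries_def raised_tree_def by (rule sum.swap)

lemma raise_at_empty [simp]: "raise_at {} t = t"
proof -
  have id: "raise_entry {} = (\<lambda>i. id)"
    by (auto simp: raise_entry_def fun_eq_iff)
  have "mapi_tree (\<lambda>i. id) n t = t" "mapi_trees (\<lambda>i. id) n ts = ts"
    for n and t :: "('x \<times> nat) tree" and ts :: "('x \<times> nat) tree list"
  proof (induction "\<lambda>i::nat. id :: 'x \<times> nat \<Rightarrow> 'x \<times> nat" n t and "\<lambda>i::nat. id :: 'x \<times> nat \<Rightarrow> 'x \<times> nat" n ts
      rule: mapi_tree_mapi_trees.induct)
    case (2 n ys ts)
    then show ?case
      by (auto intro!: nth_equalityI)
  qed simp_all
  then show ?thesis
    by (simp add: raise_at_eq id)
qed

lemma sum_bilinear_UNIV: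
  fixes sc :: "'k::comm_ring_1 \<Rightarrow> 'b::ab_group_add \<Rightarrow> 'b"
  assumes "bilinear_on sc UNIV m"
  shows "m (\<Sum>i\<in>I. u i) (\<Sum>j\<in>J. v j) = (\<Sum>i\<in>I. \<Sum>j\<in>J. m (u i) (v j))"
proof -
  have add: "m (a + b) c = m a c + m b c" "m a (b + c) = m a b + m a c" for a b c
    using assms by (auto simp: bilinear_on_def)
  have zero: "m 0 a = 0" "m a 0 = 0" for a
    using add(1) [of 0 0 a] add(2) [of a 0 0] by simp_all
  have right: "m a (\<Sum>j\<in>J. v j) = (\<Sum>j\<in>J. m a (v j))" for a
    by (induction J rule: infinite_finite_induct) (simp_all add: add zero)
  show ?thesis
    by (induction I rule: infinite_finite_induct) (simp_all add: add zero right sum.distrib)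
qed

text \<open>\<open>p \<epsilon>\<^sup>n\<close>, where \<open>\<epsilon>\<^sup>2 = \<lambda> \<epsilon>\<close>.\<close>

definition eps_power :: "'k::comm_ring_1 \<Rightarrow> nat \<Rightarrow> ('y, 'k) lc \<Rightarrow> ('y, 'k) lc \<times> ('y, 'k) lc" where
  "eps_power lam n p = (if n = 0 then (p, 0) else (0, lc_scale (lam ^ (n - 1)) p))"

text \<open>\<open>bilinext\<close> is bilinear on all combinations of trees, so the computations
  with \<open>eps_tree\<close> carry no validity conditions.\<close>

lemma bilinear_on_eps_bilinext:
  "bilinear_on (eps_scale lc_scale) UNIV (eps_op lc_scale lam (bilinext g))"
  by (auto simp: bilinear_on_def eps_op_def eps_scale_def bilinext_add_left bilinext_add_right
    bilinext_scale_left bilinext_scale_right lc_scale_add algebra_simps)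

lemma bilinext_zero [simp]: "bilinext g 0 p = 0" "bilinext g p 0 = 0"
  by (simp_all add: bilinext_eq_linext)

lemma eps_op_eps_power:
  "eps_op lc_scale lam (bilinext g) (eps_power lam m p) (eps_power lam n r)
   = eps_power lam (m + n) (bilinext g p r)"
proof (cases "m = 0 \<or> n = 0")
  \<comment> \<open>For positive exponents,
    \<open>\<epsilon> \<epsilon> = \<lambda> \<epsilon>\<close> supplies the factor
    \<open>lam\<close> missing between the exponents \<open>(m - 1) + (n - 1)\<close> and
    \<open>m + n - 1\<close>.\<close>
  case False
  then obtain m' n' where "m = Suc m'" "n = Suc n'"
    by (meson not0_implies_Suc)
  then show ?thesis
    by (simp add: eps_op_def eps_power_def bilinext_scale_left bilinext_scale_right power_add
      mult.assoc mult.commute mult.left_commute)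
qed (auto simp: eps_op_def eps_power_def bilinext_scale_left bilinext_scale_right)

text \<open>The multilinear expansion of \<open>t\<close> after each entry \<open>x^(r)\<close> has
  been replaced by \<open>x^(r) + x^(r+1) \<epsilon>\<close>.\<close>

definition eps_tree :: "'k::comm_ring_1 \<Rightarrow> ('x \<times> nat) tree \<Rightarrow> ('x \<times> nat, 'k) lc \<times> ('x \<times> nat, 'k) lc" where
  "eps_tree lam t = raised_tree t (\<lambda>n t'. eps_power lam n (basis t'))"

lemma eps_op_eps_tree:
  "eps_op lc_scale lam (bilinext g) (eps_tree lam t) (eps_tree lam s) =
   raised_tree t (\<lambda>m t'. raised_tree s (\<lambda>n s'. eps_power lam (m + n) (g t' s')))"
  unfolding eps_tree_def raised_tree_def
  by (simp add: sum_bilinear_UNIV [OF bilinear_on_eps_bilinext] eps_op_eps_power)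

text \<open>With the next two lemmas: raising entries is compatible with the products that build
  trees, because those products merely join the entries of their factors.\<close>

lemma eps_tree_single_left:
  "eps_tree lam (Node [y] [t, Leaf]) = eps_op lc_scale lam (DT_succ q) (eps_tree lam t) (eps_tree lam (corolla y))"
proof -
  have "eps_tree lam (Node [y] [t, Leaf]) =
      raised_tree t (\<lambda>n t'. raised_entries [y] (\<lambda>m y'. eps_power lam (m + n) (basis (Node y' [t', Leaf]))))"
    by (simp add: eps_tree_def raised_entries_tree_commute)
  also have "\<dots> = eps_op lc_scale lam (DT_succ q) (eps_tree lam t) (eps_tree lam (corolla y))"
    by (simp add: DT_succ_def eps_op_eps_tree corolla_def add.commute)
  finally show ?thesis .
qed

lemma eps_tree_single:
  "eps_tree lam (Node [y] [t, u]) =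
     eps_op lc_scale lam (DT_prec q) (eps_tree lam (Node [y] [t, Leaf])) (eps_tree lam u)"
proof -
  have prec: "precb q (Node xs [t', Leaf]) u' = basis (Node xs [t', u'])"
    for xs :: "('a \<times> nat) list" and t' u'
    using precb_snoc [of q xs "[t']" Leaf u'] by simp
  show ?thesis
    by (simp add: DT_prec_def eps_op_eps_tree prec) (simp add: eps_tree_def add.assoc)
qed

lemma eps_tree_Cons:
  assumes "ts \<noteq> []"
  shows "eps_tree lam (Node (y # ys) (t # ts)) =
     eps_op lc_scale lam (DT_bull q) (eps_tree lam (Node [y] [t, Leaf])) (eps_tree lam (Node ys ts))"
proof -
  obtain s ss where ts: "ts = s # ss"
    using assms by (cases ts) auto
  have bull: "bullb q (Node xs [t', Leaf]) (Node ys' (s' # ss')) = basis (Node (xs @ ys') (t' # s' # ss'))"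
    for xs ys' :: "('a \<times> nat) list" and t' s' ss'
    using bullb_snoc_Cons [of q xs "[t']" Leaf ys' s' ss'] by simp
  show ?thesis
    unfolding DT_bull_def eps_op_eps_tree ts
    by (simp add: bull raised_entries_tree_commute)
      (simp add: eps_tree_def raised_entries_Cons [of y ys] raised_entries_tree_commute add_ac)
qed

lemma eps_tree_corolla:
  "eps_tree lam (corolla (x, r)) = (basis (corolla (x, r)), basis (corolla (x, Suc r)))"
  by (simp add: eps_tree_def corolla_def raised_entries_single eps_power_def)

text \<open>The empty set gives \<open>basis t\<close>. A nonempty \<open>S\<close> contributes
  \<open>\<epsilon>\<close> to the power \<open>card S\<close>, that is
  \<open>lam ^ (card S - 1)\<close> times \<open>\<epsilon>\<close>, which is the coefficient in
  \<open>dX_basis\<close>.\<close>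

lemma eps_tree_eq: "eps_tree lam t = (basis t, dX_basis lam t)"
proof -
  let ?I = "{S. S \<subseteq> {..<nent t} \<and> S \<noteq> {}}"
  have split: "Pow {..<nent t} = insert {} ?I"
    by auto
  have "finite S" if "S \<in> ?I" for S
    using that by (auto intro: finite_subset)
  then have "(\<Sum>S\<in>?I. eps_power lam (card S) (basis (raise_at S t))) =
      (\<Sum>S\<in>?I. (0, lc_scale (lam ^ (card S - 1)) (basis (raise_at S t))))"
    by (intro sum.cong) (auto simp: eps_power_def)
  also have "\<dots> = (0, dX_basis lam t)"
    unfolding dX_basis_def by (simp add: sum_prod)
  finally show ?thesis
    unfolding eps_tree_def raised_tree_def split
    by (subst sum.insert) (auto simp: eps_power_def)
qed

lemma tridendriform_DT: "tridendriform lc_scale DT q (DT_prec q) (DT_succ q) (DT_bull q)"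
  by (rule tridendriform.intro) (rule q_tridendriform_DT)

lemma eps_tree_corolla_in: "eps_tree lam (corolla y) \<in> DT \<times> DT"
  by (cases y) (simp add: eps_tree_corolla basis_in_DT)

text \<open>Both sides agree on corollas and obey the same recursion, so \<open>eps_tree\<close> is
  an evaluation in the extended algebra and inherits multiplicativity.\<close>

lemma eval_tree_eps_tree:
  fixes q lam :: "'k::comm_ring_1" and t :: "('x \<times> nat) tree"
  assumes "valid_tree t" "t \<noteq> Leaf"
  shows "eval_tree (eps_op lc_scale lam (DT_prec q)) (eps_op lc_scale lam (DT_succ q))
    (eps_op lc_scale lam (DT_bull q)) (\<lambda>y. eps_tree lam (corolla y)) t = eps_tree lam t"
proof -
  interpret DT: tridendriform lc_scale DT q "DT_prec q" "DT_succ q" "DT_bull q"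
    by (rule tridendriform_DT)
  interpret tridendriform_generators "eps_scale lc_scale" "DT \<times> DT" q "eps_op lc_scale lam (DT_prec q)"
    "eps_op lc_scale lam (DT_succ q)" "eps_op lc_scale lam (DT_bull q)" "\<lambda>y :: 'x \<times> nat. eps_tree lam (corolla y)"
    by (intro tridendriform_generators.intro DT.tridendriform_eps tridendriform_generators_axioms.intro
        eps_tree_corolla_in)
  have "ev t = eps_tree lam t"
    using assms
  proof (induction "size t" arbitrary: t rule: less_induct)
    case less
    obtain y ys u us where t: "t = Node (y # ys) (u # us)" "length us = Suc (length ys)"
        "valid_tree u" "\<forall>v\<in>set us. valid_tree v"
      using less.prems by (cases t rule: valid_tree.cases) (auto simp: neq_Nil_conv length_Suc_conv)
    have left: "lact u (eps_tree lam (corolla y)) = eps_tree lam (Node [y] [u, Leaf])"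
    proof (cases "u = Leaf")
      case True
      then show ?thesis by (simp add: corolla_def [of y])
    next
      case False
      then have "ev u = eps_tree lam u"
        using less.hyps [of u] t by simp
      with False show ?thesis
        by (simp add: lact_def eps_tree_single_left [of _ _ u q])
    qed
    show ?case
    proof (cases ys)
      case Nil
      then obtain v where v: "us = [v]" "valid_tree v"
        using t by (auto simp: length_Suc_conv)
      show ?thesis
      proof (cases "v = Leaf")
        case True
        with Nil t(1) v left show ?thesis by simp
      next
        case False
        then have "ev v = eps_tree lam v"
          using less.hyps [of v] t v by simp
        with False t(1) v Nil left show ?thesis
          by (simp add: ract_def eps_tree_single [of _ _ _ v q])
      qed
    next
      case (Cons y' ys')
      have "ev (Node ys us) = eps_tree lam (Node ys us)"
        using less.hyps [of "Node ys us"] t Cons by simp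
      moreover have "us \<noteq> []"
        using t(2) by auto
      ultimately show ?thesis
        using t(1) left Cons by (simp add: eps_tree_Cons [of us _ _ _ _ q])
    qed
  qed
  then show ?thesis .
qed

lemma lext_eps_tree: "lext (eps_scale lc_scale) (eps_tree lam) p = (p, dX lam p)"
proof -
  have "lext (eps_scale lc_scale) (eps_tree lam) p = (linext basis p, linext (dX_basis lam) p)"
    unfolding lext_def eps_scale_def eps_tree_eq linext_def by (simp add: sum_prod)
  then show ?thesis
    by (simp add: dX_def)
qed

section \<open>Passage between derivations and homomorphisms into the extended algebra\<close>

context tridendriform
begin

lemma DT_hom_cong:
  assumes "DT_hom h" "\<And>p. p \<in> DT \<Longrightarrow> g p = h p"
  shows "DT_hom g"
  using assms by (simp add: DT_hom_def linear_on_def DT_add DT_scale DT_prec_in DT_succ_in DT_bull_in)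

abbreviation DT_eps_hom :: "'k \<Rightarrow> (('y, 'k) lc \<Rightarrow> 'b \<times> 'b) \<Rightarrow> bool" where
  "DT_eps_hom lam \<equiv> tridendriform.DT_hom (eps_scale sc) (A \<times> A) q
     (eps_op sc lam pr) (eps_op sc lam su) (eps_op sc lam bu)"

lemmas DT_eps_hom_def = tridendriform.DT_hom_def [OF tridendriform_eps]

lemma DT_eps_hom_derivation:
  assumes "DT_hom g" "linear_on sc A sc A d"
    and "derivation_wt sc A lam pr d" "derivation_wt sc A lam su d" "derivation_wt sc A lam bu d"
  shows "DT_eps_hom lam (\<lambda>p. (g p, d (g p)))"
  using assms
  by (simp add: DT_eps_hom_def DT_hom_def linear_on_def derivation_wt_def eps_op_def eps_scale_def)

end

text \<open>By \<open>lext_eps_tree\<close>, \<open>p \<mapsto> p + dX(p) \<epsilon>\<close> is an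
  evaluation map, hence a homomorphism; its second component states linearity and the Leibniz rules
  of weight \<open>lam\<close>.\<close>

lemma
  fixes q lam :: "'k::comm_ring_1"
  defines "D \<equiv> (DT :: ('x \<times> nat, 'k) lc set)"
  shows linear_on_dX: "linear_on lc_scale D lc_scale D (dX lam)"
    and derivation_dX: "derivation_wt lc_scale D lam (DT_prec q) (dX lam)"
      "derivation_wt lc_scale D lam (DT_succ q) (dX lam)"
      "derivation_wt lc_scale D lam (DT_bull q) (dX lam)"
proof -
  interpret DT: tridendriform lc_scale DT q "DT_prec q" "DT_succ q" "DT_bull q"
    by (rule tridendriform_DT)
  interpret tridendriform_generators "eps_scale lc_scale" "DT \<times> DT" q "eps_op lc_scale lam (DT_prec q)"
    "eps_op lc_scale lam (DT_succ q)" "eps_op lc_scale lam (DT_bull q)" "\<lambda>y :: 'x \<times> nat. eps_tree lam (corolla y)"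
    by (intro tridendriform_generators.intro DT.tridendriform_eps tridendriform_generators_axioms.intro
        eps_tree_corolla_in)
  have "(p, dX lam p) = lext (eps_scale lc_scale) ev p" if "p \<in> DT"
    for p :: "('x \<times> nat, 'k) lc"
    unfolding lext_eps_tree [symmetric]
    using that by (intro lext_cong) (auto simp: DT_def eval_tree_eps_tree)
  then have "DT_hom (\<lambda>p :: ('x \<times> nat, 'k) lc. (p, dX lam p))"
    by (intro DT_hom_cong [OF DT_hom_lext_ev])
  then show "linear_on lc_scale D lc_scale D (dX lam)"
      "derivation_wt lc_scale D lam (DT_prec q) (dX lam)"
      "derivation_wt lc_scale D lam (DT_succ q) (dX lam)"
      "derivation_wt lc_scale D lam (DT_bull q) (dX lam)"
    unfolding D_def by (simp_all add: DT_hom_def linear_on_def derivation_wt_def eps_op_def eps_scale_def)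
qed

text \<open>The composite of \<open>p \<mapsto> p + dX(p) \<epsilon>\<close> with the extension of
  \<open>g\<close> to coefficients in \<open>\<epsilon>\<close>.\<close>

lemma (in tridendriform) DT_eps_hom_dX:
  fixes g :: "('x \<times> nat, 'k) lc \<Rightarrow> 'b"
  assumes "DT_hom g"
  shows "DT_eps_hom lam (\<lambda>p. (g p, g (dX lam p)))"
  using assms linear_on_dX [where ?'x = 'x and lam = lam] derivation_dX [where ?'x = 'x and lam = lam and q = q]
  by (simp add: DT_eps_hom_def DT_hom_def linear_on_def derivation_wt_def eps_op_def eps_scale_def
    DT_add DT_scale DT_prec_in DT_succ_in DT_bull_in)

section \<open>The universal property over \<open>X\<close>\<close>

lemma dX_corolla: "dX lam (basis (corolla (x, n))) = basis (corolla (x, Suc n))"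
  using eps_tree_corolla [of lam x n] by (simp add: dX_def eps_tree_eq)

lemma jX_eq: "jX x = corolla (x, 0)"
  by (simp add: jX_def corolla_def)

lemma free_differential:
  fixes q lam :: "'k::comm_ring_1" and sc :: "'k \<Rightarrow> 'b::ab_group_add \<Rightarrow> 'b" and f :: "'x \<Rightarrow> 'b"
  assumes diff: "diff_q_tridendriform sc T q lam pT uT bT dT" and f: "\<And>x. f x \<in> T"
  shows "\<exists>fb. diff_tri_hom lc_scale DT (DT_prec q) (DT_succ q) (DT_bull q) (dX lam) sc T pT uT bT dT fb
    \<and> (\<forall>x. fb (basis (jX x)) = f x)
    \<and> (\<forall>g. diff_tri_hom lc_scale DT (DT_prec q) (DT_succ q) (DT_bull q) (dX lam) sc T pT uT bT dT g
            \<and> (\<forall>x. g (basis (jX x)) = f x) \<longrightarrow> (\<forall>p\<in>DT. g p = fb p))"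
proof -
  \<comment> \<open>These values are forced on the generators \<open>x^(n)\<close>, as
    \<open>dX\<close> sends \<open>x^(n)\<close> to \<open>x^(n+1)\<close> and the map must commute
    with the derivations.\<close>
  define f' where "f' = (\<lambda>(x, n). (dT ^^ n) (f x))"
  have d: "linear_on sc T sc T dT" "derivation_wt sc T lam pT dT" "derivation_wt sc T lam uT dT"
      "derivation_wt sc T lam bT dT"
    using diff by (auto simp: diff_q_tridendriform_def)
  then have d_in: "a \<in> T \<Longrightarrow> dT a \<in> T" for a
    by (simp add: linear_on_def)
  have "(dT ^^ n) (f x) \<in> T" for x n
    by (induction n) (simp_all add: f d_in)
  then have f'_in: "f' y \<in> T" for y
    by (cases y) (simp add: f'_def)
  have f'_Suc: "dT (f' (x, n)) = f' (x, Suc n)" for x n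
    by (simp add: f'_def)
  interpret tridendriform_generators sc T q pT uT bT f'
    using diff f'_in by unfold_locales (auto simp: diff_q_tridendriform_def)
  interpret eps: tridendriform_generators "eps_scale sc" "T \<times> T" q "eps_op sc lam pT" "eps_op sc lam uT"
    "eps_op sc lam bT" "\<lambda>y. (f' y, dT (f' y))"
    by (intro tridendriform_generators.intro tridendriform_eps tridendriform_generators_axioms.intro)
      (simp add: d_in f'_in)
  have hom_iff: "diff_tri_hom lc_scale DT (DT_prec q) (DT_succ q) (DT_bull q) (dX lam) sc T pT uT bT dT g
      \<longleftrightarrow> DT_hom g \<and> (\<forall>p\<in>DT. dT (g p) = g (dX lam p))" for g
    by (simp add: diff_tri_hom_def DT_hom_def)
  define fb where "fb = lext sc ev"
  have fb: "DT_hom fb" "\<And>y. fb (basis (corolla y)) = f' y"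
    by (simp_all add: fb_def DT_hom_lext_ev)
  \<comment> \<open>The maps \<open>p \<mapsto> (fb p, dT (fb p))\<close> and
    \<open>p \<mapsto> (fb p, fb (dX lam p))\<close> are homomorphisms into the extension of
    \<open>T\<close> with the same values on corollas, hence equal on \<open>DT\<close>.\<close>
  have "dT (fb p) = fb (dX lam p)" if "p \<in> DT" for p
  proof -
    have "(fb p, dT (fb p)) = lext (eps_scale sc) eps.ev p"
      using DT_eps_hom_derivation [OF fb(1) d] that by (intro eps.DT_hom_unique) (simp_all add: fb(2))
    also have "(fb (basis (corolla y)), fb (dX lam (basis (corolla y)))) = (f' y, dT (f' y))" for y
      by (cases y) (simp add: dX_corolla fb(2) f'_Suc)
    then have "lext (eps_scale sc) eps.ev p = (fb p, fb (dX lam p))"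
      using DT_eps_hom_dX [OF fb(1), of lam] that by (intro eps.DT_hom_unique [symmetric])
    finally show ?thesis
      by simp
  qed
  with fb(1) have "diff_tri_hom lc_scale DT (DT_prec q) (DT_succ q) (DT_bull q) (dX lam) sc T pT uT bT dT fb"
    by (simp add: hom_iff)
  moreover have "fb (basis (jX x)) = f x" for x
    by (simp add: jX_eq fb(2) f'_def)
  moreover have "g p = fb p"
    if g: "diff_tri_hom lc_scale DT (DT_prec q) (DT_succ q) (DT_bull q) (dX lam) sc T pT uT bT dT g"
      and gj: "\<And>x. g (basis (jX x)) = f x" and "p \<in> DT"
    for g and p :: "('x \<times> nat, 'k) lc"
  proof -
    have hom: "DT_hom g" and gd: "\<And>p. p \<in> DT \<Longrightarrow> g (dX lam p) = dT (g p)"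
      using g by (simp_all add: hom_iff)
    \<comment> \<open>Compatibility with the derivations propagates the prescribed value at
      \<open>x^(0)\<close> to every \<open>x^(n)\<close>, after which freeness over all decorations
      applies.\<close>
    have "g (basis (corolla (x, n))) = f' (x, n)" for x n
    proof (induction n)
      case 0
      show ?case
        using gj [of x] by (simp add: jX_eq f'_def)
    next
      case (Suc n)
      then show ?case
        using gd [of "basis (corolla (x, n))"] by (simp add: basis_in_DT dX_corolla f'_Suc)
    qed
    then have "g (basis (corolla y)) = f' y" for y
      by (cases y) simp
    then show ?thesis
      unfolding fb_def using hom that(3) by (intro DT_hom_unique)
  qed
  ultimately show ?thesis
    by blast
qed

theorem theorem5p4:
  fixes q lam :: "'k::comm_ring_1"
  shows "diff_q_tridendriform lc_scale (DT :: ('x \<times> nat, 'k) lc set) q lam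
           (DT_prec q) (DT_succ q) (DT_bull q) (dX lam)
         \<and> (\<forall>x. basis (jX x) \<in> (DT :: ('x \<times> nat, 'k) lc set))
         \<and> (\<forall>(sc :: 'k \<Rightarrow> 'b::ab_group_add \<Rightarrow> 'b) T pT uT bT dT (f :: 'x \<Rightarrow> 'b).
              diff_q_tridendriform sc T q lam pT uT bT dT \<and> (\<forall>x. f x \<in> T) \<longrightarrow>
              (\<exists>fb. diff_tri_hom lc_scale DT (DT_prec q) (DT_succ q) (DT_bull q) (dX lam)
                                 sc T pT uT bT dT fb
                    \<and> (\<forall>x. fb (basis (jX x)) = f x)
                    \<and> (\<forall>g. diff_tri_hom lc_scale DT (DT_prec q) (DT_succ q) (DT_bull q) (dX lam)
                                 sc T pT uT bT dT g
                          \<and> (\<forall>x. g (basis (jX x)) = f x)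
                          \<longrightarrow> (\<forall>p\<in>DT. g p = fb p))))"
proof (intro conjI allI impI)
  show "diff_q_tridendriform lc_scale (DT :: ('x \<times> nat, 'k) lc set) q lam
      (DT_prec q) (DT_succ q) (DT_bull q) (dX lam)"
    unfolding diff_q_tridendriform_def
    by (intro conjI q_tridendriform_DT linear_on_dX derivation_dX)
  show "basis (jX x) \<in> (DT :: ('x \<times> nat, 'k) lc set)" for x :: 'x
    by (simp add: jX_eq basis_in_DT)
next
  fix sc :: "'k \<Rightarrow> 'b \<Rightarrow> 'b" and T pT uT bT dT and f :: "'x \<Rightarrow> 'b"
  assume "diff_q_tridendriform sc T q lam pT uT bT dT \<and> (\<forall>x. f x \<in> T)"
  then have "diff_q_tridendriform sc T q lam pT uT bT dT" "\<And>x. f x \<in> T"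
    by blast+
  from free_differential [OF this]
  show "\<exists>fb. diff_tri_hom lc_scale DT (DT_prec q) (DT_succ q) (DT_bull q) (dX lam) sc T pT uT bT dT fb
    \<and> (\<forall>x. fb (basis (jX x)) = f x)
    \<and> (\<forall>g. diff_tri_hom lc_scale DT (DT_prec q) (DT_succ q) (DT_bull q) (dX lam) sc T pT uT bT dT g
            \<and> (\<forall>x. g (basis (jX x)) = f x) \<longrightarrow> (\<forall>p\<in>DT. g p = fb p))" .
qed

end
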